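(* Let $G$ be a finite bipartite graph drawn in the plane, with $n$ white vertices and $n'$ black vertices. Let $A$ be a generalized Kasteleyn matrix for $G$, let $\mathbf{a}\in H^1(G,\mathbb{S}^1)$ be the class defined by $A$, and let $P_{\mathbf{a}}(t)=t^n+a_1t^{n-1}+\cdots+a_{n-1}t+a_n$ be the singular polynomial of $A$, i.e. the characteristic polynomial $\det(tI-AA^\ast)$. Then, for each $1\le m\le n$, $$a_m=(-1)^m\sum_{|H|=2m}\delta(\mathbf{a}+\mathbf{k}_H,H),$$ where $H$ ranges over all balanced (induced) subgraphs of $G$ with $2m$ vertices, and in the term for $H$ the symbol $\mathbf{a}$ denotes the restriction $\pi_{G,H}(\mathbf{a})\in H^1(H,\mathbb{S}^1)$.
   Context: Graphs are finite, simple, bipartite (vertices coloured white and black, edges joining white to black) and drawn in the plane; they are viewed as 1-dimensional CW-complexes. A subgraph is drawn in the plane with the inherited drawing. A subgraph is balanced if it has as many white as black vertices; subgraphs $H$ are taken to be induced (full), so they are determined by their vertex sets. Groups and characters. $\mathbb{S}^1$ denotes the additive group $\mathbb{R}/\mathbb{Z}$ and $\eta:\mathbb{S}^1\to\mathbb{C}$ is $\eta(x)=\exp(2\pi i x)$. The group $\mathbb{Z}/(2)$ is included in $\mathbb{S}^1$ by $m\mapsto m/2$, so $\eta(m)=(-1)^m$ on $\mathbb{Z}/(2)$; hence $H^1(G,\mathbb{Z}/(2))\subseteq H^1(G,\mathbb{S}^1)$. Elements of $H^1(G,\mathbb{S}^1)=\mathrm{Hom}(H_1(G,\mathbb{Z}),\mathbb{S}^1)$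 are evaluated on closed 1-chains. Generalized Kasteleyn matrix. For $G$ with white vertices numbered $1,\dots,n$ and black vertices numbered $1,\dots,n'$, it is an $n\times n'$ complex matrix $A$ with $|a_{ij}|=1$ if the $i$-th white vertex and $j$-th black vertex are adjacent, and $a_{ij}=0$ otherwise. It corresponds to the 1-cochain $\mathbf{A}\in C^1(G,\mathbb{S}^1)$ with $a_{ij}=\eta(\mathbf{A}(e_{ij}))$, where $e_{ij}$ is the edge oriented from the $j$-th black to the $i$-th white vertex; $\mathbf{A}$ is automatically closed and so defines a class $\mathbf{a}\in H^1(G,\mathbb{S}^1)$. The singular polynomial depends only on $\mathbf{a}$. Restriction. For $H\subseteq G$, $\pi_{G,H}:H^1(G,\mathbb{S}^1)\to H^1(H,\mathbb{S}^1)$ is induced by the inclusion. Kasteleyn class. $\mathbf{k}_H\in H^1(H,\mathbb{Z}/(2))$ is the unique class such that for every graph-theoretic cycle (simple closed curve made of edges) $C$ in $H$, $\mathbf{k}_H(C)\equiv m_C+l_C+1\pmod 2$, where $m_C$ is the number of vertices of $H$ in the interior of $C$ (in the plane) and $2l_C$ is the length of $C$. Matchings and $\delta$. Matchings are perfect matchings. A matching is regarded as the 1-chain equal to the sum of its edges oriented from black to white; the difference of two matchings is closed. For $\mathbf{b}\in H^1(H,\mathbb{S}^1)$, $\delta(\mathbf{b},H)=\sum_{\mu_1,\mu_2}\eta(\mathbf{b}(\mu_1-\mu_2))$, where $\mu_1,\mu_2$ range over all matchings of $H$ (and $\delta(\mathbf{b},H)=0$ if $H$ has no matchings). *)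

theory Defs
  imports
    "HOL-Analysis.Analysis"
    "HOL-Library.Z2"
    "Jordan_Normal_Form.Schur_Decomposition"
begin

section \<open>The group \<open>\<real>/\<int>\<close>\<close>

definition int_congruent :: "real \<Rightarrow> real \<Rightarrow> bool" where
  "int_congruent x y \<longleftrightarrow> x - y \<in> \<int>"

quotient_type circle = real / int_congruent
  morphisms rep_circle circle
proof (rule equivpI)
  show "reflp int_congruent"
    by (rule reflpI) (simp add: int_congruent_def)
  show "symp int_congruent"
    by (rule sympI) (metis Ints_minus int_congruent_def minus_diff_eq)
  show "transp int_congruent"
  proof (rule transpI)
    fix x y z assume "int_congruent x y" "int_congruent y z"
    then have "(x - y) + (y - z) \<in> \<int>"
      unfolding int_congruent_def by (rule Ints_add)
    then show "int_congruent x z" by (simp add: int_congruent_def)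
  qed
qed

instantiation circle :: ab_group_add
begin

lift_definition zero_circle :: circle is 0 .

lift_definition plus_circle :: "circle \<Rightarrow> circle \<Rightarrow> circle" is "(+)"
  unfolding int_congruent_def by (metis Ints_add add_diff_add)

lift_definition uminus_circle :: "circle \<Rightarrow> circle" is uminus
  unfolding int_congruent_def by (metis Ints_minus minus_diff_minus)

lift_definition minus_circle :: "circle \<Rightarrow> circle \<Rightarrow> circle" is "(-)"
  unfolding int_congruent_def by (metis Ints_diff diff_diff_eq diff_diff_eq2 add.commute diff_add_eq)

instance
  by standard (transfer, simp add: int_congruent_def algebra_simps)+

end

lift_definition int_scale :: "int \<Rightarrow> circle \<Rightarrow> circle" is "\<lambda>k x. of_int k * x"
  unfolding int_congruent_def by (metis Ints_mult Ints_of_int right_diff_distrib)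

lift_definition \<eta> :: "circle \<Rightarrow> complex" is "\<lambda>x. exp (2 * of_real pi * \<i> * of_real x)"
proof -
  fix x y :: real assume "int_congruent x y"
  then obtain k where "x - y = of_int k"
    unfolding int_congruent_def by (auto elim: Ints_cases)
  then have "x = y + of_int k" by simp
  then show "exp (2 * of_real pi * \<i> * of_real x) = exp (2 * of_real pi * \<i> * of_real y)"
    unfolding exp_eq by (intro exI[of _ k]) (simp add: algebra_simps)
qed

text \<open>The inclusion \<open>m \<mapsto> m/2\<close> of \<open>\<int>/(2)\<close>, represented by \<^typ>\<open>bit\<close>.\<close>

definition half :: "bit \<Rightarrow> circle" where
  "half m = circle (if m = 1 then 1/2 else 0)"


section \<open>Bipartite plane graphs\<close>

text \<open>
  Vertices are points of the plane. An edge is a pair \<open>(b, w)\<close> of a black and a white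
  vertex, hence oriented from black to white, and it is drawn as an arbitrary (continuous,
  injective) arc from \<open>b\<close> to \<open>w\<close>.
\<close>

record plane_graph =
  white :: "complex set"
  black :: "complex set"
  edges :: "(complex \<times> complex) set"
  drawing :: "complex \<times> complex \<Rightarrow> real \<Rightarrow> complex"

definition verts :: "plane_graph \<Rightarrow> complex set" where
  "verts G = white G \<union> black G"

definition plane_bipartite_graph :: "plane_graph \<Rightarrow> bool" where
  "plane_bipartite_graph G \<longleftrightarrow>
     finite (white G) \<and> finite (black G) \<and> white G \<inter> black G = {} \<and>
     edges G \<subseteq> black G \<times> white G \<and>
     (\<forall>e\<in>edges G. arc (drawing G e) \<and>
        pathstart (drawing G e) = fst e \<and> pathfinish (drawing G e) = snd e \<and>
        path_image (drawing G e) \<inter> verts G = {fst e, snd e}) \<and>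
     (\<forall>e\<in>edges G. \<forall>e'\<in>edges G. e \<noteq> e' \<longrightarrow>
        path_image (drawing G e) \<inter> path_image (drawing G e') \<subseteq> verts G)"

definition induced_subgraph :: "plane_graph \<Rightarrow> complex set \<Rightarrow> plane_graph" where
  "induced_subgraph G U =
     G\<lparr>white := white G \<inter> U, black := black G \<inter> U, edges := edges G \<inter> (U \<times> U)\<rparr>"

definition induced_subgraphs :: "plane_graph \<Rightarrow> plane_graph set" where
  "induced_subgraphs G = induced_subgraph G ` Pow (verts G)"

definition balanced :: "plane_graph \<Rightarrow> bool" where
  "balanced H \<longleftrightarrow> card (white H) = card (black H)"


section \<open>Cohomology\<close>

type_synonym chain = "complex \<times> complex \<Rightarrow> int"

definition boundary :: "plane_graph \<Rightarrow> chain \<Rightarrow> complex \<Rightarrow> int" where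
  "boundary G c v =
     (\<Sum>e\<in>edges G. c e * ((if snd e = v then 1 else 0) - (if fst e = v then 1 else 0)))"

text \<open>A graph has no 2-cells, so \<open>H\<^sub>1(G, \<int>)\<close> is the group of closed (cellular) 1-chains.\<close>

definition H1 :: "plane_graph \<Rightarrow> chain set" where
  "H1 G = {c. (\<forall>e. e \<notin> edges G \<longrightarrow> c e = 0) \<and> (\<forall>v\<in>verts G. boundary G c v = 0)}"

text \<open>
  \<open>H\<^sup>1(G, R) = Hom(H\<^sub>1(G, \<int>), R)\<close>. Homomorphisms are normalized to be \<open>0\<close> off
  \<open>H\<^sub>1(G, \<int>)\<close>, so that distinct functions are distinct classes and classes are added
  pointwise.
\<close>

definition Cohomology1 :: "plane_graph \<Rightarrow> (chain \<Rightarrow> 'r::ab_group_add) set" where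
  "Cohomology1 G = {f. (\<forall>c\<in>H1 G. \<forall>d\<in>H1 G. f (\<lambda>e. c e + d e) = f c + f d) \<and>
                       (\<forall>c. c \<notin> H1 G \<longrightarrow> f c = 0)}"

definition cochain_class ::
  "plane_graph \<Rightarrow> (complex \<times> complex \<Rightarrow> circle) \<Rightarrow> chain \<Rightarrow> circle" where
  "cochain_class G \<alpha> c =
     (if c \<in> H1 G then \<Sum>e\<in>edges G. int_scale (c e) (\<alpha> e) else 0)"

text \<open>
  The restriction to a subgraph \<open>H\<close>. Pushing a chain of \<open>H\<close> forward along the inclusion
  is extension by zero, which is already part of the representation of chains.
\<close>

definition restrict_class :: "plane_graph \<Rightarrow> (chain \<Rightarrow> circle) \<Rightarrow> chain \<Rightarrow> circle" where
  "restrict_class H f c = (if c \<in> H1 H then f c else 0)"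


section \<open>The Kasteleyn class\<close>

text \<open>
  A cycle is given by the list of its vertices in cyclic order, without repeating the
  first one at the end.
\<close>

definition cycle_steps :: "complex list \<Rightarrow> (complex \<times> complex) set" where
  "cycle_steps vs = set (zip vs (rotate1 vs))"

definition is_cycle :: "plane_graph \<Rightarrow> complex list \<Rightarrow> bool" where
  "is_cycle G vs \<longleftrightarrow> 3 \<le> length vs \<and> distinct vs \<and>
     (\<forall>(u, v)\<in>cycle_steps vs. (u, v) \<in> edges G \<or> (v, u) \<in> edges G)"

definition cycle_chain :: "plane_graph \<Rightarrow> complex list \<Rightarrow> chain" where
  "cycle_chain G vs e =
     (if e \<in> edges G
      then (if e \<in> cycle_steps vs then 1 else 0)
         - (if prod.swap e \<in> cycle_steps vs then 1 else 0)
      else 0)"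

definition cycle_curve :: "plane_graph \<Rightarrow> complex list \<Rightarrow> complex set" where
  "cycle_curve G vs =
     (\<Union>e\<in>{e\<in>edges G. e \<in> cycle_steps vs \<or> prod.swap e \<in> cycle_steps vs}.
        path_image (drawing G e))"

definition interior_vertices :: "plane_graph \<Rightarrow> complex list \<Rightarrow> nat" where
  "interior_vertices G vs = card (verts G \<inter> inside (cycle_curve G vs))"

definition kasteleyn_class :: "plane_graph \<Rightarrow> chain \<Rightarrow> bit" where
  "kasteleyn_class H =
     (THE k. k \<in> Cohomology1 H \<and>
        (\<forall>vs. is_cycle H vs \<longrightarrow>
           k (cycle_chain H vs) = of_nat (interior_vertices H vs + length vs div 2 + 1)))"


section \<open>Generalized Kasteleyn matrices\<close>

text \<open>
  A numbering of a finite set is a list; the \<open>i\<close>-th white vertex is \<open>ws ! (i - 1)\<close>,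
  since list positions and matrix indices start at \<open>0\<close>.
\<close>

definition numbering :: "complex set \<Rightarrow> complex list \<Rightarrow> bool" where
  "numbering V vs \<longleftrightarrow> distinct vs \<and> set vs = V"

definition generalized_kasteleyn_matrix ::
  "plane_graph \<Rightarrow> complex list \<Rightarrow> complex list \<Rightarrow> complex Matrix.mat \<Rightarrow> bool" where
  "generalized_kasteleyn_matrix G ws bs A \<longleftrightarrow>
     A \<in> carrier_mat (length ws) (length bs) \<and>
     (\<forall>i<length ws. \<forall>j<length bs.
        if (bs ! j, ws ! i) \<in> edges G then cmod (A $$ (i, j)) = 1 else A $$ (i, j) = 0)"

definition kasteleyn_cochain ::
  "plane_graph \<Rightarrow> complex list \<Rightarrow> complex list \<Rightarrow> complex Matrix.mat
     \<Rightarrow> complex \<times> complex \<Rightarrow> circle" where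
  "kasteleyn_cochain G ws bs A =
     (THE \<alpha>. (\<forall>e. e \<notin> edges G \<longrightarrow> \<alpha> e = 0) \<and>
        (\<forall>i<length ws. \<forall>j<length bs. (bs ! j, ws ! i) \<in> edges G \<longrightarrow>
           A $$ (i, j) = \<eta> (\<alpha> (bs ! j, ws ! i))))"

definition matrix_class ::
  "plane_graph \<Rightarrow> complex list \<Rightarrow> complex list \<Rightarrow> complex Matrix.mat \<Rightarrow> chain \<Rightarrow> circle" where
  "matrix_class G ws bs A = cochain_class G (kasteleyn_cochain G ws bs A)"

definition singular_polynomial :: "complex Matrix.mat \<Rightarrow> complex poly" where
  "singular_polynomial A = char_poly (A * mat_adjoint A)"


section \<open>Matchings\<close>

definition matchings :: "plane_graph \<Rightarrow> (complex \<times> complex) set set" where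
  "matchings H = {M. M \<subseteq> edges H \<and> (\<forall>v\<in>verts H. \<exists>!e. e \<in> M \<and> (fst e = v \<or> snd e = v))}"

definition matching_chain :: "(complex \<times> complex) set \<Rightarrow> chain" where
  "matching_chain M e = (if e \<in> M then 1 else 0)"

definition \<delta> :: "(chain \<Rightarrow> circle) \<Rightarrow> plane_graph \<Rightarrow> complex" where
  "\<delta> b H = (\<Sum>\<mu>1\<in>matchings H. \<Sum>\<mu>2\<in>matchings H.
     \<eta> (b (\<lambda>e. matching_chain \<mu>1 e - matching_chain \<mu>2 e)))"

end

theory Submission
  imports Defs "HOL-Complex_Analysis.Winding_Numbers" "HOL-Combinatorics.Cycles"
begin

text \<open>
  Let \<open>G\<close> have white vertices numbered by \<open>i < n\<close> and black ones by \<open>j < n'\<close>. Expanding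
  \<open>det (t I - A A\<^sup>*)\<close> along the set of positions where the diagonal \<open>t\<close> is chosen expresses
  \<open>(-1)\<^sup>m a\<^sub>m\<close> as the sum of the principal \<open>m\<close>-minors of \<open>A A\<^sup>*\<close> (\<open>coeff_char_poly\<close>). The
  Cauchy-Binet argument turns the minor on \<open>I\<close> into a sum over bijections \<open>f\<close> from \<open>I\<close> to
  \<open>m\<close>-sets \<open>J\<close> of black indices and permutations \<open>\<sigma>\<close> of \<open>I\<close>, with term
  \<open>sign \<sigma> * (\<Prod>i. a\<^bsub>i,f i\<^esub>) * cnj (\<Prod>i. a\<^bsub>i,f (\<sigma> i)\<^esub>)\<close> (\<open>minor_of_product\<close>). Only those \<open>f\<close>
  and \<open>f \<circ> \<sigma>\<close> survive that use edges, i.e. pairs \<open>\<mu>\<^sub>1, \<mu>\<^sub>2\<close> of matchings of the balanced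
  subgraph \<open>H\<close> on \<open>I\<close> and \<open>J\<close> (\<open>matchings_subgraph_on\<close>). The two products give
  \<open>\<eta> (a (\<mu>\<^sub>1 - \<mu>\<^sub>2))\<close>, so the theorem says that \<open>sign \<sigma> = \<eta> (k\<^sub>H (\<mu>\<^sub>1 - \<mu>\<^sub>2))\<close>.

  For this, decompose \<open>\<sigma>\<close> into cyclic permutations. One of length \<open>l \<ge> 2\<close> traces a graph cycle
  \<open>C\<close> with \<open>2 l\<close> vertices along which the two matchings alternate. Its sign is \<open>(-1)\<close> to the power \<open>l + 1\<close>, while
  \<open>k\<^sub>H (C) = m\<^sub>C + l + 1\<close>; and \<open>m\<^sub>C\<close> is even because the vertices off \<open>C\<close> are matched among
  themselves by edges that do not cross \<open>C\<close> (\<open>even_interior\<close>, \<open>kasteleyn_class_of_permutation\<close>).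

  The remaining point is that the class \<open>k\<^sub>H\<close> is well defined. Uniqueness holds because graph
  cycles generate \<open>H\<^sub>1\<close> (\<open>Cohomology1_eqI\<close>). Existence is where planarity enters. By an argument
  of Zaslavsky, a function on the cycles of a finite graph with values in \<open>\<int>/(2)\<close> is the sum of edge weights
  as soon as it is additive on theta graphs, i.e. on three internally disjoint paths with common ends
  (\<open>sum_of_edge_weights\<close>). To see that \<open>m\<^sub>C + l\<^sub>C + 1\<close> is additive, note that one of three arcs
  forming a theta curve runs inside the closed curve formed by the other two (\<open>theta_arc_inside\<close>)
  and splits its interior. If the paths have \<open>p\<^sub>1, p\<^sub>2, p\<^sub>3\<close> edges and the second is the inner one,
  then \<open>m\<^bsub>13\<^esub> = m\<^bsub>12\<^esub> + m\<^bsub>23\<^esub> + (p\<^sub>2 - 1)\<close> and \<open>l\<^bsub>12\<^esub> + l\<^bsub>23\<^esub> = l\<^bsub>13\<^esub> + p\<^sub>2\<close>, whence the claim modulo 2.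
\<close>

section \<open>Theta-additive functions on cycles are sums of edge weights\<close>

text \<open>
  Paths and cycles are vertex lists and edges are two-element sets. This makes the weight of a path
  indifferent to the direction in which it is run through, as suits coefficients modulo 2.
\<close>

fun walk_edges :: "'a list \<Rightarrow> 'a set list" where
  "walk_edges (u # v # vs) = {u, v} # walk_edges (v # vs)"
| "walk_edges vs = []"

abbreviation cycle_edges :: "'a list \<Rightarrow> 'a set list" where
  "cycle_edges vs \<equiv> walk_edges (vs @ [hd vs])"

definition cycle_in :: "'a set set \<Rightarrow> 'a list \<Rightarrow> bool" where
  "cycle_in E vs \<longleftrightarrow> 3 \<le> length vs \<and> distinct vs \<and> set (cycle_edges vs) \<subseteq> E"

abbreviation weight :: "('a set \<Rightarrow> bit) \<Rightarrow> 'a list \<Rightarrow> bit" where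
  "weight \<kappa> vs \<equiv> sum_list (map \<kappa> (walk_edges vs))"

text \<open>
  The right-hand side contains an instance of the left-hand side (with \<open>ys = []\<close>), so this is a fact to be
  instantiated and not a rewrite rule; \<open>walk_edges_split\<close> is a terminating variant.
\<close>

lemma walk_edges_append: "walk_edges (xs @ a # ys) = walk_edges (xs @ [a]) @ walk_edges (a # ys)"
proof (induction xs)
  case (Cons x xs) then show ?case by (cases xs) auto
qed simp

lemma walk_edges_split:
  "walk_edges (x @ a # y @ b # z) = walk_edges (x @ [a]) @ walk_edges (a # y @ [b]) @ walk_edges (b # z)"
  using walk_edges_append[of x a "y @ b # z"] walk_edges_append[of "a # y" b z] by simp

lemma walk_edges_rev: "walk_edges (rev xs) = rev (walk_edges xs)"
proof (induction xs rule: walk_edges.induct)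
  case (1 u v vs)
  have "walk_edges (rev (u # v # vs)) = walk_edges (rev vs @ v # [u])" by simp
  also have "\<dots> = walk_edges (rev (v # vs)) @ [{v, u}]" by (subst walk_edges_append) simp
  finally show ?case using 1 by (simp add: insert_commute)
qed auto

lemma walk_edges_conv: "walk_edges vs = map (\<lambda>(u, v). {u, v}) (zip vs (tl vs))"
  by (induction vs rule: walk_edges.induct) auto

lemma walk_edges_subset: "e \<in> set (walk_edges vs) \<Longrightarrow> e \<subseteq> set vs"
  by (induction vs rule: walk_edges.induct) auto

lemma cycle_edges_rotate: "set (cycle_edges (x @ y)) = set (cycle_edges (y @ x))"
  "weight \<kappa> ((x @ y) @ [hd (x @ y)]) = weight \<kappa> ((y @ x) @ [hd (y @ x)])"
proof -
  have *: "cycle_edges (x @ y) = walk_edges (x @ [hd y]) @ walk_edges (y @ [hd x])" if xy: "x \<noteq> []" "y \<noteq> []" for x y :: "'a list"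
  proof -
    obtain b y' where y: "y = b # y'" using xy(2) by (cases y) auto
    show ?thesis using walk_edges_append[of x b "y' @ [hd x]"] xy by (simp add: y)
  qed
  have "set (cycle_edges (x @ y)) = set (cycle_edges (y @ x)) \<and>
    weight \<kappa> ((x @ y) @ [hd (x @ y)]) = weight \<kappa> ((y @ x) @ [hd (y @ x)])"
  proof (cases "x = [] \<or> y = []")
    case False
    then have ne: "x \<noteq> []" "y \<noteq> []" by auto
    show ?thesis unfolding *[OF ne] *[OF ne(2,1)]
      by (simp only: set_append map_append sum_list_append Un_commute add.commute simp_thms)
  qed auto
  then show "set (cycle_edges (x @ y)) = set (cycle_edges (y @ x))"
    "weight \<kappa> ((x @ y) @ [hd (x @ y)]) = weight \<kappa> ((y @ x) @ [hd (y @ x)])" by blast+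
qed

lemma cycle_in_rotate: "cycle_in E (x @ y) \<Longrightarrow> cycle_in E (y @ x)"
  unfolding cycle_in_def using cycle_edges_rotate(1)[of x y] by auto

lemma cycle_edges_rev:
  assumes "vs \<noteq> []"
  shows "set (cycle_edges (rev vs)) = set (cycle_edges vs)"
    "weight \<kappa> (rev vs @ [hd (rev vs)]) = weight \<kappa> (vs @ [hd vs])"
proof -
  obtain a xs where vs: "vs = a # xs" using assms by (cases vs) auto
  have 1: "walk_edges (a # rev xs @ [a]) = rev (walk_edges (a # xs @ [a]))"
    using walk_edges_rev[of "a # xs @ [a]"] by simp
  show "set (cycle_edges (rev vs)) = set (cycle_edges vs)"
    using cycle_edges_rotate(1)[of "[a]" "rev xs"] 1 by (simp add: vs)
  show "weight \<kappa> (rev vs @ [hd (rev vs)]) = weight \<kappa> (vs @ [hd vs])"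
    using cycle_edges_rotate(2)[of \<kappa> "[a]" "rev xs"] 1 by (simp add: vs rev_map[symmetric] sum_list_rev)
qed

lemma cycle_edges_closing:
  assumes "vs \<noteq> []" shows "cycle_edges vs = walk_edges vs @ [{last vs, hd vs}]"
proof -
  obtain ys y where "vs = ys @ [y]" using assms by (cases vs rule: rev_cases) auto
  then show ?thesis using walk_edges_append[of ys y "[hd vs]"] by simp
qed

lemma closing_edge_not_in_walk:
  assumes "distinct vs" "3 \<le> length vs"
  shows "{last vs, hd vs} \<notin> set (walk_edges vs)"
proof -
  obtain a b c xs where vs: "vs = a # b # c # xs"
    using assms(2) by (metis Suc_le_length_iff numeral_3_eq_3)
  show ?thesis
    using assms(1) walk_edges_subset[of "{last vs, a}" "b # c # xs"]
    unfolding vs by (auto simp: doubleton_eq_iff)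
qed

text \<open>
  Every cycle through an edge can be rotated so that this edge is the one that closes the list. What
  remains is a path between the ends of the edge.
\<close>

lemma cycle_through_edge:
  assumes "cycle_in E vs" "{u, v} \<in> set (cycle_edges vs)"
  obtains x y where "vs = x @ y" "{hd (y @ x), last (y @ x)} = {u, v}"
proof -
  obtain i where i: "i < length (cycle_edges vs)" "cycle_edges vs ! i = {u, v}"
    using assms(2) by (metis in_set_conv_nth)
  have ne: "vs \<noteq> []" using assms(1) by (auto simp: cycle_in_def)
  have len: "i < length vs" using i(1) ne by (simp add: walk_edges_conv)
  have e: "{(vs @ [hd vs]) ! i, (vs @ [hd vs]) ! Suc i} = {u, v}"
  proof -
    have "tl (vs @ [hd vs]) ! i = (vs @ [hd vs]) ! Suc i" by (rule nth_tl) (simp add: len)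
    moreover have "i < length (zip (vs @ [hd vs]) (tl (vs @ [hd vs])))" using len by simp
    ultimately show ?thesis using i(2) unfolding walk_edges_conv by (simp only: nth_map nth_zip length_zip min_less_iff_conj split)
  qed
  show ?thesis
  proof (cases "Suc i = length vs")
    case True
    then have "{hd vs, last vs} = {u, v}"
      using e len ne unfolding True[symmetric] by (simp add: nth_append last_conv_nth True[symmetric] insert_commute)
    then show ?thesis using that[of "[]" vs] by simp
  next
    case False
    then have l: "Suc i < length vs" using len by simp
    have "hd (drop (Suc i) vs) = vs ! Suc i" "last (take (Suc i) vs) = vs ! i"
      using l by (simp_all add: hd_drop_conv_nth take_Suc_conv_app_nth)
    then have "{hd (drop (Suc i) vs @ take (Suc i) vs), last (drop (Suc i) vs @ take (Suc i) vs)} = {u, v}"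
      using l e len ne by (simp add: nth_append insert_commute)
    then show ?thesis using that[of "take (Suc i) vs" "drop (Suc i) vs"] by simp
  qed
qed

text \<open>
  The three paths of a theta graph lead from \<open>a\<close> to \<open>b\<close> and have interior vertices \<open>x\<close>, \<open>y\<close>, \<open>z\<close>. Distinctness of
  the vertices in the three cycles makes the paths internally disjoint, and the minimal cycle length of
  3 excludes that two of them are the same edge.
\<close>

locale theta_additive =
  fixes E :: "'a set set" and f :: "'a list \<Rightarrow> bit"
  assumes finite_E: "finite E"
    and f_rotate: "\<And>x y. cycle_in E (x @ y) \<Longrightarrow> f (y @ x) = f (x @ y)"
    and f_rev: "\<And>vs. cycle_in E vs \<Longrightarrow> f (rev vs) = f vs"
    and f_theta: "\<And>a b x y z. cycle_in E (a # x @ b # rev y) \<Longrightarrow> cycle_in E (a # y @ b # rev z) \<Longrightarrow>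
      cycle_in E (a # x @ b # rev z) \<Longrightarrow>
      f (a # x @ b # rev z) = f (a # x @ b # rev y) + f (a # y @ b # rev z)"
begin

text \<open>
  Let all cycles in \<open>F\<close> have the right weight, and let two paths in \<open>F\<close> be closed up by the same new
  edge \<open>{u, v}\<close>. Then both cycles require the same weight for that edge. The paths agree up to \<open>a\<close>;
  where the second leaves the first and comes back to it, it forms an ear. Exchanging
  the corresponding part of the first path for this ear changes \<open>f\<close> by the value on a cycle in \<open>F\<close>, by
  theta-additivity, and makes the paths agree further.
\<close>

lemma ear_exchange:
  assumes F: "F \<subseteq> E" "{u, v} \<in> E" "{u, v} \<notin> F" "u \<noteq> v"
    and \<kappa>: "\<And>vs. cycle_in F vs \<Longrightarrow> f vs = weight \<kappa> (vs @ [hd vs])"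
    and P: "distinct (x @ a # p)" "hd (x @ a # p) = u" "last (x @ a # p) = v"
      "set (walk_edges (x @ a # p)) \<subseteq> F"
    and Q: "distinct (x @ a # q)" "hd (x @ a # q) = u" "last (x @ a # q) = v"
      "set (walk_edges (x @ a # q)) \<subseteq> F"
  shows "f (x @ a # p) + weight \<kappa> (x @ a # p) = f (x @ a # q) + weight \<kappa> (x @ a # q)"
  using P Q
proof (induction "length q" arbitrary: x a p q rule: less_induct)
  case less
  have long: "3 \<le> length R"
    if R: "distinct R" "hd R = u" "last R = v" "set (walk_edges R) \<subseteq> F" "R \<noteq> []" for R
  proof (rule ccontr)
    assume "\<not> 3 \<le> length R"
    then obtain c d where "R = [c] \<or> R = [c, d]"
      using R(5) by (cases R rule: walk_edges.cases) (auto simp: Suc_le_eq)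
    then show False using R F by auto
  qed
  have cyc: "cycle_in E R" if R: "distinct R" "hd R = u" "last R = v" "set (walk_edges R) \<subseteq> F" "R \<noteq> []" for R
    unfolding cycle_in_def cycle_edges_closing[OF R(5)] using long[OF R] R F
    by (auto simp: insert_commute)
  consider "q = []" | "p = []" | "p \<noteq> []" "q \<noteq> []" "hd p = hd q" | "p \<noteq> []" "q \<noteq> []" "hd p \<noteq> hd q"
    by blast
  then show ?case
  proof cases
    case 1 
    then have "a = v" using less.prems by simp
    moreover have "last p = v" "v \<in> set p" if "p \<noteq> []"
      using that less.prems last_in_set[OF that] by auto
    ultimately have "p = []" using less.prems by auto
    with 1 show ?thesis by simp
  next
    case 2
    then have "a = v" using less.prems by simp
    moreover have "last q = v" "v \<in> set q" if "q \<noteq> []"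
      using that less.prems last_in_set[OF that] by auto
    ultimately have "q = []" using less.prems by auto
    with 2 show ?thesis by simp
  next
    case 3
    then obtain c p' q' where "p = c # p'" "q = c # q'" by (metis list.exhaust list.sel(1))
    then show ?thesis using less.hyps[of q' "x @ [a]" c p'] less.prems by simp
  next
    case 4
    \<comment> \<open>The ear is \<open>r\<close>, from \<open>a\<close> to the first vertex \<open>b\<close> of \<open>q\<close> that lies on \<open>p\<close>; it replaces \<open>y\<close>.\<close>
    have "last p = last q" using less.prems 4 by simp
    then have "\<exists>b\<in>set q. b \<in> set p" using 4 last_in_set by metis
    then obtain r b s where q: "q = r @ b # s" and b: "b \<in> set p" and r: "\<forall>c\<in>set r. c \<notin> set p"
      using split_list_first_prop[of q "\<lambda>b. b \<in> set p"] by blast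
    obtain y z where p: "p = y @ b # z" using split_list[OF b] by blast
    let ?P = "x @ a # y @ b # z" and ?R = "x @ a # r @ b # z"
    have R: "distinct ?R" "hd ?R = u" "last ?R = v" "set (walk_edges ?R) \<subseteq> F"
    proof -
      show "distinct ?R" using less.prems r unfolding p q by auto
      show "hd ?R = u" using less.prems by (cases x) auto
      show "last ?R = v" using less.prems(3) unfolding p by (auto split: if_splits)
      show "set (walk_edges ?R) \<subseteq> F" using less.prems(4,8) unfolding p q
        by (auto simp: walk_edges_split)
    qed
    have IH: "f ?R + weight \<kappa> ?R = f (x @ a # q) + weight \<kappa> (x @ a # q)"
      using less.hyps[of s "x @ a # r" b z] R less.prems(5-8) unfolding q by simp
    have c1: "cycle_in E ?P" "cycle_in E ?R"
      using cyc[of ?P] cyc[of ?R] R less.prems unfolding p by auto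
    have yr: "y \<noteq> [] \<or> r \<noteq> []" using 4 p q by auto
    have c2: "cycle_in F (a # y @ b # rev r)"
    proof -
      have "walk_edges (a # y @ b # rev r @ [a]) = walk_edges (a # y @ [b]) @ rev (walk_edges (a # r @ [b]))"
        using walk_edges_append[of "a # y" b "rev r @ [a]"] walk_edges_rev[of "a # r @ [b]"] by simp
      moreover have "set (walk_edges (a # y @ [b])) \<subseteq> F" "set (walk_edges (a # r @ [b])) \<subseteq> F"
        using less.prems(4,8) unfolding p q
        by (auto simp: walk_edges_split)
      moreover have "distinct (a # y @ b # rev r)" using less.prems r unfolding p q by auto
      moreover have "3 \<le> length (a # y @ b # rev r)" using yr by (cases y; cases r) auto
      ultimately show ?thesis unfolding cycle_in_def by auto
    qed
    have w2: "f (a # y @ b # rev r) = weight \<kappa> (a # y @ [b]) + weight \<kappa> (a # r @ [b])"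
      using \<kappa>[OF c2] walk_edges_append[of "a # y" b "rev r @ [a]"] walk_edges_rev[of "a # r @ [b]"]
      by (simp add: rev_map[symmetric] sum_list_rev)
    \<comment> \<open>The third path of the theta graph leads from \<open>a\<close> back along \<open>x\<close>, through the edge \<open>{u, v}\<close>, and back along \<open>z\<close> to \<open>b\<close>.\<close>
    have c3: "cycle_in E (a # y @ b # rev (rev x @ rev z))" "cycle_in E (a # r @ b # rev (rev x @ rev z))"
      using cycle_in_rotate[of E x "a # y @ b # z"] cycle_in_rotate[of E x "a # r @ b # z"] c1 by auto
    have c2E: "cycle_in E (a # y @ b # rev r)" using c2 F(1) unfolding cycle_in_def by auto
    have f3: "f (a # y @ b # rev (rev x @ rev z)) = f ?P" "f (a # r @ b # rev (rev x @ rev z)) = f ?R"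
      using f_rotate[of x "a # y @ b # z"] f_rotate[of x "a # r @ b # z"] c1 by auto
    have "f ?P = f (a # y @ b # rev r) + f ?R"
      using f_theta[OF c2E c3(2) c3(1)] unfolding f3 .
    moreover have "weight \<kappa> ?P = weight \<kappa> (x @ [a]) + weight \<kappa> (a # y @ [b]) + weight \<kappa> (b # z)"
      "weight \<kappa> ?R = weight \<kappa> (x @ [a]) + weight \<kappa> (a # r @ [b]) + weight \<kappa> (b # z)"
      by (simp_all only: walk_edges_split map_append sum_list_append add.assoc)
    moreover have "(p + q + g) + (w + p + t) = g + (w + q + t)" for p q g w t :: bit
      by (cases p; cases q; cases g; cases w; cases t; simp)
    ultimately have "f ?P + weight \<kappa> ?P = f ?R + weight \<kappa> ?R"
      unfolding w2 by (simp only:)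
    then show ?thesis using IH unfolding p by simp
  qed
qed

text \<open>
  Edges are added one at a time. The weight of a new edge is forced by any one cycle through it, and
  \<open>ear_exchange\<close> says that all other cycles through it agree with this choice.
\<close>

theorem sum_of_edge_weights:
  "\<exists>\<kappa>. \<forall>vs. cycle_in E vs \<longrightarrow> f vs = weight \<kappa> (vs @ [hd vs])"
proof -
  have "\<exists>\<kappa>. \<forall>vs. cycle_in F vs \<longrightarrow> f vs = weight \<kappa> (vs @ [hd vs])" if "F \<subseteq> E" for F
    using finite_subset[OF that finite_E] that
  proof (induction F)
    case empty
    have "\<not> cycle_in {} vs" for vs :: "'a list"
    proof
      assume "cycle_in {} vs"
      then have "vs \<noteq> []" "cycle_edges vs = []" by (auto simp: cycle_in_def)
      then show False using cycle_edges_closing[of vs] by simp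
    qed
    then show ?case by simp
  next
    case (insert e F)
    then obtain \<kappa> where \<kappa>: "\<And>vs. cycle_in F vs \<Longrightarrow> f vs = weight \<kappa> (vs @ [hd vs])" by auto
    define through where "through P \<longleftrightarrow> 3 \<le> length P \<and> distinct P \<and> {last P, hd P} = e \<and> set (walk_edges P) \<subseteq> F" for P
    have upd: "weight (\<kappa>(e := d)) P = weight \<kappa> P" if "set (walk_edges P) \<subseteq> F" for P d
      using that insert.hyps(2) by (intro arg_cong[where f = sum_list] map_cong) auto
    have red: "cycle_in F vs \<or> (\<exists>P. through P \<and> cycle_in E P \<and> f P = f vs \<and>
        (\<forall>\<kappa>. weight \<kappa> (P @ [hd P]) = weight \<kappa> (vs @ [hd vs])))"
      if vs: "cycle_in (insert e F) vs" for vs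
    proof (cases "e \<in> set (cycle_edges vs)")
      case True
      have E: "cycle_in E vs" using vs insert.prems by (auto simp: cycle_in_def)
      have ne: "vs \<noteq> []" using vs by (auto simp: cycle_in_def)
      obtain u v where e: "e = {u, v}" using True by (auto simp: walk_edges_conv)
      obtain x y where xy: "vs = x @ y" "{hd (y @ x), last (y @ x)} = {u, v}"
        using cycle_through_edge[OF vs] True unfolding e by metis
      let ?P = "y @ x"
      have cP: "cycle_in (insert e F) ?P" "cycle_in E ?P" using vs E xy cycle_in_rotate by blast+
      then have "{last ?P, hd ?P} \<notin> set (walk_edges ?P)" 
        by (intro closing_edge_not_in_walk) (auto simp: cycle_in_def)
      then have "through ?P" using cP cycle_edges_closing[of ?P] xy(2) ne xy(1)
        unfolding through_def e cycle_in_def by (auto simp: insert_commute)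
      then show ?thesis using cP f_rotate[of x y] E cycle_edges_rotate(2)[of _ y x] unfolding xy(1) by blast
    qed (use vs in \<open>auto simp: cycle_in_def\<close>)
    show ?case
    proof (cases "\<exists>P. through P")
      case False
      then show ?thesis using red \<kappa> by blast
    next
      case True
      then obtain P0 where P0: "through P0" by blast
      let ?\<kappa> = "\<kappa>(e := f P0 + weight \<kappa> P0)"
      have key: "f P + weight \<kappa> P = f P0 + weight \<kappa> P0" if P: "through P" "hd P = hd P0" for P
      proof -
        obtain u p q where "P = u # p" "P0 = u # q"
          using P P0 unfolding through_def by (cases P; cases P0) auto
        moreover have "last P = last P0"
          using P P0 unfolding through_def by (metis doubleton_eq_iff)
        moreover have "hd P0 \<noteq> last P0" using P0 unfolding through_def
          by (cases P0) (auto split: if_splits)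
        ultimately show ?thesis
          using ear_exchange[of F "hd P0" "last P0" \<kappa> "[]" u p q] P P0 \<kappa> insert.prems insert.hyps
          unfolding through_def by (auto simp: insert_commute)
      qed
      have rv: "through (rev P)" if "through P" for P
        using that unfolding through_def by (auto simp: walk_edges_rev hd_rev last_rev insert_commute)
      have "f vs = weight ?\<kappa> (vs @ [hd vs])" if vs: "cycle_in (insert e F) vs" for vs
        using red[OF vs]
      proof
        assume c: "cycle_in F vs"
        then have "weight ?\<kappa> (vs @ [hd vs]) = weight \<kappa> (vs @ [hd vs])"
          by (intro upd) (simp add: cycle_in_def)
        then show ?thesis using \<kappa>[OF c] by simp
      next
        assume "\<exists>P. through P \<and> cycle_in E P \<and> f P = f vs \<and>
          (\<forall>\<kappa>. weight \<kappa> (P @ [hd P]) = weight \<kappa> (vs @ [hd vs]))"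
        then obtain P where P: "through P" "cycle_in E P" "f P = f vs"
          "\<And>\<kappa>. weight \<kappa> (P @ [hd P]) = weight \<kappa> (vs @ [hd vs])" by blast
        have ne: "P \<noteq> []" using P(1) by (auto simp: through_def)
        have kP: "f P + weight \<kappa> P = f P0 + weight \<kappa> P0"
        proof (cases "hd P = hd P0")
          case True then show ?thesis using key P by blast
        next
          case False
          then have "hd (rev P) = hd P0" using P(1) P0 unfolding through_def
            by (metis doubleton_eq_iff hd_rev)
          then have "f (rev P) + weight \<kappa> (rev P) = f P0 + weight \<kappa> P0" using key rv P by blast
          then show ?thesis using f_rev P by (simp add: walk_edges_rev rev_map[symmetric] sum_list_rev)
        qed
        have "weight ?\<kappa> (P @ [hd P]) = weight ?\<kappa> P + ?\<kappa> e"
          using P(1) unfolding cycle_edges_closing[OF ne] through_def by auto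
        also have "\<dots> = weight \<kappa> P + (f P + weight \<kappa> P)"
          using upd[of P] P(1) kP by (simp add: through_def)
        also have "\<dots> = f P" by (cases "f P"; cases "weight \<kappa> P") auto
        finally show ?thesis using P by simp
      qed
      then show ?thesis by blast
    qed
  qed
  then show ?thesis by blast
qed

end

section \<open>Theta curves in the plane\<close>

lemma inside_two_arcs:
  fixes c1 c2 :: "real \<Rightarrow> complex"
  assumes "arc c1" "pathstart c1 = a" "pathfinish c1 = b"
    and "arc c2" "pathstart c2 = a" "pathfinish c2 = b"
    and "path_image c1 \<inter> path_image c2 = {a, b}"
  defines "S \<equiv> path_image c1 \<union> path_image c2"
  shows "simple_path (c1 +++ reversepath c2)" "path_image (c1 +++ reversepath c2) = S"
    "inside S \<noteq> {}" "connected (inside S)" "frontier (inside S) = S" "open (inside S)"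
    "inside S \<inter> S = {}"
proof -
  show sp: "simple_path (c1 +++ reversepath c2)"
    using assms by (intro simple_path_join_loop) (auto simp: arc_reversepath)
  show im: "path_image (c1 +++ reversepath c2) = S"
    using assms by (simp add: path_image_join)
  have "pathfinish (c1 +++ reversepath c2) = pathstart (c1 +++ reversepath c2)" using assms by simp
  from Jordan_inside_outside[OF sp this, unfolded im]
  show "inside S \<noteq> {}" "connected (inside S)" "frontier (inside S) = S" "open (inside S)" by auto
  show "inside S \<inter> S = {}" by (auto simp: inside_def)
qed

text \<open>
  Otherwise each of the three arcs avoids the interior of the other two, so each of the three interiors
  is a component of the complement of the theta curve. A point inside \<open>c1 \<union> c2\<close> is inside another of
  the closed curves too, since the winding numbers of the three curves, suitably oriented, add up to zero.
  Two of the components then coincide, hence so do their frontiers, which is absurd.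
\<close>

lemma theta_arc_inside:
  fixes c1 c2 c3 :: "real \<Rightarrow> complex"
  assumes c1: "arc c1" "pathstart c1 = a" "pathfinish c1 = b"
    and c2: "arc c2" "pathstart c2 = a" "pathfinish c2 = b"
    and c3: "arc c3" "pathstart c3 = a" "pathfinish c3 = b"
    and i: "path_image c1 \<inter> path_image c2 = {a, b}" "path_image c1 \<inter> path_image c3 = {a, b}"
      "path_image c2 \<inter> path_image c3 = {a, b}"
  shows "path_image c1 \<inter> inside (path_image c2 \<union> path_image c3) \<noteq> {} \<or>
    path_image c2 \<inter> inside (path_image c1 \<union> path_image c3) \<noteq> {} \<or>
    path_image c3 \<inter> inside (path_image c1 \<union> path_image c2) \<noteq> {}"
proof (rule ccontr)
  let ?P1 = "path_image c1" and ?P2 = "path_image c2" and ?P3 = "path_image c3"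
  assume "\<not> ?thesis"
  then have out: "?P1 \<inter> inside (?P2 \<union> ?P3) = {}" "?P2 \<inter> inside (?P1 \<union> ?P3) = {}"
    "?P3 \<inter> inside (?P1 \<union> ?P2) = {}" by auto
  note J12 = inside_two_arcs[OF c1 c2 i(1)] and J13 = inside_two_arcs[OF c1 c3 i(2)]
    and J23 = inside_two_arcs[OF c2 c3 i(3)]
  have eq: "I = J" if "connected I" "connected J" "I \<inter> J \<noteq> {}" "I \<inter> frontier J = {}" "J \<inter> frontier I = {}"
    for I J :: "complex set"
    using connected_Int_frontier[of I J] connected_Int_frontier[of J I] that by auto
  obtain z where z: "z \<in> inside (?P1 \<union> ?P2)" using J12(3) by auto
  have zn: "z \<notin> ?P1" "z \<notin> ?P2" "z \<notin> ?P3" using z J12(7) out(3) by blast+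
  have p: "path c1" "path c2" "path c3" using c1 c2 c3 by (auto simp: arc_imp_path)
  let ?w = winding_number
  have w: "?w (c1 +++ reversepath c2) z = ?w c1 z - ?w c2 z"
    "?w (c1 +++ reversepath c3) z = ?w c1 z - ?w c3 z"
    "?w (c2 +++ reversepath c3) z = ?w c2 z - ?w c3 z"
    using p zn c1 c2 c3 by (simp_all add: winding_number_join winding_number_reversepath)
  have n1: "norm (?w c1 z - ?w c2 z) = 1"
    using simple_closed_path_norm_winding_number_inside[OF J12(1), of z] z unfolding w(1) J12(2) by simp
  have n13: "?w c1 z = ?w c3 z" if "z \<notin> inside (?P1 \<union> ?P3)"
  proof -
    have "z \<in> outside (?P1 \<union> ?P3)" using that zn inside_Un_outside[of "?P1 \<union> ?P3"] by blast
    then have "?w (c1 +++ reversepath c3) z = 0"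
      using J13(1,2) c1 c3 by (intro winding_number_zero_in_outside) (auto simp: simple_path_def)
    then show ?thesis using w(2) by simp
  qed
  have n23: "?w c2 z = ?w c3 z" if "z \<notin> inside (?P2 \<union> ?P3)"
  proof -
    have "z \<in> outside (?P2 \<union> ?P3)" using that zn inside_Un_outside[of "?P2 \<union> ?P3"] by blast
    then have "?w (c2 +++ reversepath c3) z = 0"
      using J23(1,2) c2 c3 by (intro winding_number_zero_in_outside) (auto simp: simple_path_def)
    then show ?thesis using w(3) by simp
  qed
  have disj: "inside (?P1 \<union> ?P2) \<inter> (?P1 \<union> ?P3) = {}" "inside (?P1 \<union> ?P2) \<inter> (?P2 \<union> ?P3) = {}"
    "inside (?P1 \<union> ?P3) \<inter> (?P1 \<union> ?P2) = {}" "inside (?P2 \<union> ?P3) \<inter> (?P1 \<union> ?P2) = {}"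
    using J12(7) J13(7) J23(7) out by blast+
  have "z \<in> inside (?P1 \<union> ?P3) \<or> z \<in> inside (?P2 \<union> ?P3)"
    using n1 n13 n23 by (cases "z \<in> inside (?P1 \<union> ?P3)"; cases "z \<in> inside (?P2 \<union> ?P3)") simp_all
  then have "?P1 \<union> ?P2 = ?P1 \<union> ?P3 \<or> ?P1 \<union> ?P2 = ?P2 \<union> ?P3"
  proof
    assume "z \<in> inside (?P1 \<union> ?P3)"
    then have "inside (?P1 \<union> ?P2) = inside (?P1 \<union> ?P3)"
      using eq[OF J12(4) J13(4)] z disj unfolding J12(5) J13(5) by blast
    then show ?thesis using J12(5) J13(5) by metis
  next
    assume "z \<in> inside (?P2 \<union> ?P3)"
    then have "inside (?P1 \<union> ?P2) = inside (?P2 \<union> ?P3)"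
      using eq[OF J12(4) J23(4)] z disj unfolding J12(5) J23(5) by blast
    then show ?thesis using J12(5) J23(5) by metis
  qed
  then have "?P1 \<subseteq> {a, b} \<or> ?P2 \<subseteq> {a, b}" using i by blast
  moreover have "\<not> path_image c \<subseteq> {a, b}" if c: "arc c" for c
  proof
    assume "path_image c \<subseteq> {a, b}"
    then have "finite (path_image c)" by (rule finite_subset) simp
    then obtain x where x: "path_image c = {x}"
      using connected_finite_iff_sing[of "path_image c"] connected_path_image[OF arc_imp_path[OF c]] path_image_nonempty[of c] by blast
    have "pathfinish c \<noteq> pathstart c" by (rule arc_distinct_ends[OF c])
    moreover have "pathstart c \<in> {x}" "pathfinish c \<in> {x}" unfolding x[symmetric] by (rule pathstart_in_path_image pathfinish_in_path_image)+
    ultimately show False by simp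
  qed
  ultimately show False using c1 c2 by blast
qed

lemma split_card_inside:
  fixes c1 c2 c3 :: "real \<Rightarrow> complex"
  assumes c1: "arc c1" "pathstart c1 = a" "pathfinish c1 = b"
    and c2: "arc c2" "pathstart c2 = a" "pathfinish c2 = b"
    and c3: "arc c3" "pathstart c3 = a" "pathfinish c3 = b"
    and i: "path_image c1 \<inter> path_image c2 = {a, b}" "path_image c1 \<inter> path_image c3 = {a, b}"
      "path_image c2 \<inter> path_image c3 = {a, b}"
    and ins: "path_image c3 \<inter> inside (path_image c1 \<union> path_image c2) \<noteq> {}"
    and V: "finite V"
  shows "card (V \<inter> inside (path_image c1 \<union> path_image c2)) =
    card (V \<inter> inside (path_image c1 \<union> path_image c3)) + card (V \<inter> inside (path_image c2 \<union> path_image c3))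
    + card (V \<inter> (path_image c3 - {a, b}))"
proof -
  have "a \<noteq> b" using c1 arc_distinct_ends by blast
  let ?A = "inside (path_image c1 \<union> path_image c3)" and ?B = "inside (path_image c2 \<union> path_image c3)"
    and ?C = "path_image c3 - {a, b}"
  have d: "?A \<inter> ?B = {}" and u: "?A \<union> ?B \<union> ?C = inside (path_image c1 \<union> path_image c2)"
    using split_inside_simple_closed_curve[OF arc_imp_simple_path[OF c1(1)] c1(2,3) arc_imp_simple_path[OF c2(1)] c2(2,3)
      arc_imp_simple_path[OF c3(1)] c3(2,3) \<open>a \<noteq> b\<close> i ins] by blast+
  have "?A \<inter> path_image c3 = {}" "?B \<inter> path_image c3 = {}" by (auto simp: inside_def)
  then have "card ((V \<inter> ?A) \<union> (V \<inter> ?B) \<union> (V \<inter> ?C)) = card (V \<inter> ?A) + card (V \<inter> ?B) + card (V \<inter> ?C)"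
    using V d by (subst card_Un_disjoint; (subst card_Un_disjoint)?; auto)
  moreover have "(V \<inter> ?A) \<union> (V \<inter> ?B) \<union> (V \<inter> ?C) = V \<inter> inside (path_image c1 \<union> path_image c2)"
    using u by blast
  ultimately show ?thesis by simp
qed

text \<open>
  The points of \<open>V\<close> inside the outer curve are those inside the two inner curves and those on the
  inner arc. Any of the three arcs may be the inner one, hence the disjunction.
\<close>

theorem theta_card_inside:
  fixes c1 c2 c3 :: "real \<Rightarrow> complex"
  assumes c1: "arc c1" "pathstart c1 = a" "pathfinish c1 = b"
    and c2: "arc c2" "pathstart c2 = a" "pathfinish c2 = b"
    and c3: "arc c3" "pathstart c3 = a" "pathfinish c3 = b"
    and i: "path_image c1 \<inter> path_image c2 = {a, b}" "path_image c1 \<inter> path_image c3 = {a, b}"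
      "path_image c2 \<inter> path_image c3 = {a, b}"
    and V: "finite V"
  defines "N \<equiv> \<lambda>c c'. card (V \<inter> inside (path_image c \<union> path_image c'))"
    and "n \<equiv> \<lambda>c. card (V \<inter> (path_image c - {a, b}))"
  shows "N c1 c2 = N c1 c3 + N c2 c3 + n c3 \<or> N c1 c3 = N c1 c2 + N c2 c3 + n c2 \<or>
    N c2 c3 = N c1 c2 + N c1 c3 + n c1"
proof -
  have i': "path_image c2 \<inter> path_image c1 = {a, b}" "path_image c3 \<inter> path_image c1 = {a, b}"
    "path_image c3 \<inter> path_image c2 = {a, b}" using i by blast+
  note s1 = split_card_inside[OF c2 c3 c1 i(3) i'(1,2) _ V]
    and s2 = split_card_inside[OF c1 c3 c2 i(2) i(1) i'(3) _ V]
    and s3 = split_card_inside[OF c1 c2 c3 i _ V]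
  have comm: "N c c' = N c' c" for c c' by (simp add: N_def Un_commute)
  from theta_arc_inside[OF c1 c2 c3 i] show ?thesis
    unfolding N_def n_def by (elim disjE) (simp_all add: s1 s2 s3 Un_commute)
qed

section \<open>Cycles of a plane bipartite graph\<close>

abbreviation uedge :: "complex \<times> complex \<Rightarrow> complex set" where
  "uedge e \<equiv> {fst e, snd e}"

definition uedges :: "plane_graph \<Rightarrow> complex set set" where
  "uedges H = uedge ` edges H"

lemma mem_uedges: "{u, v} \<in> uedges H \<longleftrightarrow> (u, v) \<in> edges H \<or> (v, u) \<in> edges H"
  by (force simp: uedges_def doubleton_eq_iff)

lemma cycle_edges_conv:
  fixes vs :: "'a list"
  assumes "vs \<noteq> []"
  shows "cycle_edges vs = map (\<lambda>(u, v). {u, v}) (zip vs (rotate1 vs))"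
proof -
  have "zip (vs @ [hd vs]) (tl (vs @ [hd vs])) = zip vs (rotate1 vs)"
  proof -
    have "zip (xs @ zs) ys = zip xs ys" if "length xs = length ys" for xs ys zs :: "'a list"
      using that by (simp add: zip_append1)
    moreover have "tl (vs @ [hd vs]) = rotate1 vs" using assms by (cases vs) auto
    ultimately show ?thesis by (simp only: length_rotate1)
  qed
  then show ?thesis by (simp add: walk_edges_conv)
qed

lemma mem_cycle_edges:
  assumes "vs \<noteq> []"
  shows "uedge e \<in> set (cycle_edges vs) \<longleftrightarrow> e \<in> cycle_steps vs \<or> prod.swap e \<in> cycle_steps vs"
  unfolding cycle_edges_conv[OF assms] cycle_steps_def
  by (cases e) (force simp: doubleton_eq_iff image_iff)

lemma is_cycle_iff: "is_cycle H vs \<longleftrightarrow> cycle_in (uedges H) vs"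
proof (cases "vs = []")
  case False
  then show ?thesis
    unfolding is_cycle_def cycle_in_def cycle_edges_conv[OF False] cycle_steps_def
    by (auto simp: mem_uedges)
qed (auto simp: is_cycle_def cycle_in_def)

text \<open>
  The part of the drawing that belongs to a set of undirected edges; \<open>cycle_curve\<close> is the case of the
  edges of a cycle.
\<close>

definition curve :: "plane_graph \<Rightarrow> complex set set \<Rightarrow> complex set" where
  "curve H S = (\<Union>e\<in>{e \<in> edges H. uedge e \<in> S}. path_image (drawing H e))"

lemma curve_Un: "curve H (S \<union> S') = curve H S \<union> curve H S'"
  by (auto simp: curve_def)

lemma cycle_curve_conv: "vs \<noteq> [] \<Longrightarrow> cycle_curve H vs = curve H (set (cycle_edges vs))"
  by (simp add: cycle_curve_def curve_def mem_cycle_edges)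

lemma Union_walk_edges: "2 \<le> length vs \<Longrightarrow> \<Union> (set (walk_edges vs)) = set vs"
proof (induction vs rule: walk_edges.induct)
  case (1 u v vs)
  then show ?case by (cases vs) auto
qed auto

lemma theta_walks_disjoint:
  assumes "cycle_in E (a # x @ b # rev y)"
  shows "set (walk_edges (a # x @ [b])) \<inter> set (walk_edges (a # y @ [b])) = {}"
proof (rule equals0I)
  fix e assume e: "e \<in> set (walk_edges (a # x @ [b])) \<inter> set (walk_edges (a # y @ [b]))"
  have d: "distinct (a # x @ b # rev y)" "x \<noteq> [] \<or> y \<noteq> []"
    using assms by (auto simp: cycle_in_def)
  have "e \<subseteq> {a, b}" 
    using e walk_edges_subset[of e "a # x @ [b]"] walk_edges_subset[of e "a # y @ [b]"] d by auto
  moreover obtain u v where "e = {u, v}" "u \<noteq> v"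
  proof -
    have "\<exists>u v. e = {u, v} \<and> u \<noteq> v" if "distinct xs" "e \<in> set (walk_edges xs)" for xs
      using that by (induction xs rule: walk_edges.induct) auto
    from this[of "a # x @ [b]"] show ?thesis using e d that by auto
  qed
  ultimately have e': "e = {b, a}" by auto
  have "{b, a} \<notin> set (walk_edges (a # w @ [b]))" if "distinct (a # w @ [b])" "w \<noteq> []" for w
  proof -
    have "3 \<le> length (a # w @ [b])" using that(2) by (cases w) simp_all
    from closing_edge_not_in_walk[OF that(1) this] show ?thesis by simp
  qed
  moreover have "distinct (a # x @ [b])" "distinct (a # y @ [b])" using d(1) by simp_all
  ultimately show False using d(2) e unfolding e' by blast
qed

lemma theta_cycle_edges:
  "set (cycle_edges (a # x @ b # rev y)) = set (walk_edges (a # x @ [b])) \<union> set (walk_edges (a # y @ [b]))"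
  using walk_edges_append[of "a # x" b "rev y @ [a]"] walk_edges_rev[of "a # y @ [b]"] by simp

lemma of_nat_bit_parity: "(of_nat n :: bit) = of_bool (odd n)"
  by (induction n) auto

text \<open>
  Here \<open>k1\<close>, \<open>k2\<close>, \<open>k3\<close> count the vertices inside the three cycles of a theta graph and
  \<open>l1\<close>, \<open>l2\<close>, \<open>l3\<close> those in the interior of its paths, so that \<open>(l1 + l2 + 2) div 2\<close> is half the length of a cycle.
\<close>

lemma theta_count_parity:
  fixes k1 k2 k3 l1 l2 l3 :: nat
  assumes "even (l1 + l2)" "even (l1 + l3)" "even (l2 + l3)"
    and "k1 = k2 + k3 + l3 \<or> k2 = k1 + k3 + l2 \<or> k3 = k1 + k2 + l1"
  shows "even ((k1 + (l1 + l2 + 2) div 2 + 1) + (k2 + (l1 + l3 + 2) div 2 + 1) + (k3 + (l2 + l3 + 2) div 2 + 1))"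
proof -
  obtain p q r where *: "l1 + l2 = 2 * p" "l1 + l3 = 2 * q" "l2 + l3 = 2 * r"
    using assms(1-3) unfolding dvd_def by blast
  have "l3 + p = q + r" "l2 + q = p + r" "l1 + r = p + q" using * by linarith+
  note ** = this
  have "\<exists>h. k1 + k2 + k3 + p + q + r = 2 * h"
    using assms(4)
  proof (elim disjE)
    assume "k1 = k2 + k3 + l3"
    then show ?thesis using ** by (intro exI[of _ "k2 + k3 + q + r"]) simp
  next
    assume "k2 = k1 + k3 + l2"
    then show ?thesis using ** by (intro exI[of _ "k1 + k3 + p + r"]) simp
  next
    assume "k3 = k1 + k2 + l1"
    then show ?thesis using ** by (intro exI[of _ "k1 + k2 + p + q"]) simp
  qed
  then have "even (k1 + k2 + k3 + p + q + r)" unfolding dvd_def .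
  then have "even ((k1 + k2 + k3 + p + q + r) + 2 * 3)" by (rule dvd_add) (rule dvd_triv_left)
  moreover have "(k1 + (l1 + l2 + 2) div 2 + 1) + (k2 + (l1 + l3 + 2) div 2 + 1) + (k3 + (l2 + l3 + 2) div 2 + 1)
    = (k1 + k2 + k3 + p + q + r) + 2 * 3" unfolding * by simp
  ultimately show ?thesis by (simp only:)
qed

locale bipartite_plane_graph =
  fixes H :: plane_graph
  assumes plane: "plane_bipartite_graph H"
begin

lemma finite_verts: "finite (verts H)"
  using plane by (auto simp: plane_bipartite_graph_def verts_def)

lemma edge_ends: "e \<in> edges H \<Longrightarrow> fst e \<in> black H \<and> snd e \<in> white H"
  using plane by (auto simp: plane_bipartite_graph_def)

lemma colours_disjoint: "v \<in> white H \<Longrightarrow> v \<in> black H \<Longrightarrow> False"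
  using plane by (auto simp: plane_bipartite_graph_def)

lemma finite_edges: "finite (edges H)"
  using plane finite_subset[of "edges H" "black H \<times> white H"] by (auto simp: plane_bipartite_graph_def)

lemma edge_asym: "(u, v) \<in> edges H \<Longrightarrow> (v, u) \<notin> edges H"
  using edge_ends colours_disjoint by fastforce

lemma edge_neq: "(u, v) \<in> edges H \<Longrightarrow> u \<noteq> v"
  using edge_asym by blast

lemma inj_uedge: "inj_on uedge (edges H)"
  using edge_asym by (auto simp: inj_on_def doubleton_eq_iff)

lemma drawing_arc:
  assumes "e \<in> edges H"
  shows "arc (drawing H e)" "pathstart (drawing H e) = fst e" "pathfinish (drawing H e) = snd e"
    "path_image (drawing H e) \<inter> verts H = {fst e, snd e}"
  using assms plane unfolding plane_bipartite_graph_def by blast+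

lemma drawing_Int:
  "e \<in> edges H \<Longrightarrow> e' \<in> edges H \<Longrightarrow> e \<noteq> e' \<Longrightarrow>
    path_image (drawing H e) \<inter> path_image (drawing H e') \<subseteq> verts H"
  using plane unfolding plane_bipartite_graph_def by blast

lemma curve_verts:
  assumes "S \<subseteq> uedges H" shows "curve H S \<inter> verts H = \<Union>S"
proof
  show "curve H S \<inter> verts H \<subseteq> \<Union>S"
    using drawing_arc(4) unfolding curve_def by blast
  show "\<Union>S \<subseteq> curve H S \<inter> verts H"
  proof
    fix v assume "v \<in> \<Union>S"
    then obtain e where "e \<in> edges H" "uedge e \<in> S" "v \<in> uedge e" using assms by (auto simp: uedges_def)
    then show "v \<in> curve H S \<inter> verts H" using drawing_arc(4) unfolding curve_def by blast
  qed
qed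

text \<open>
  Two edges meet only in vertices, and an edge contains no vertices but its ends.
\<close>

lemma curve_Int:
  assumes "S \<subseteq> uedges H" "S' \<subseteq> uedges H" "S \<inter> S' = {}"
  shows "curve H S \<inter> curve H S' = \<Union>S \<inter> \<Union>S'"
proof -
  have "curve H S \<inter> curve H S' \<subseteq> verts H"
    using drawing_Int assms(3) unfolding curve_def by blast
  then show ?thesis using curve_verts[OF assms(1)] curve_verts[OF assms(2)] by blast
qed

text \<open>
  The drawings of the edges of a path join to an arc, because consecutive edges share exactly one end
  and the other edges avoid both of its ends.
\<close>

lemma walk_arc:
  assumes "2 \<le> length vs" "distinct vs" "set (walk_edges vs) \<subseteq> uedges H"
  shows "\<exists>g. arc g \<and> pathstart g = hd vs \<and> pathfinish g = last vs \<and>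
    path_image g = curve H (set (walk_edges vs))"
  using assms
proof (induction vs rule: walk_edges.induct)
  case (1 u v vs)
  have single: "\<exists>g. arc g \<and> pathstart g = u \<and> pathfinish g = v \<and> path_image g = curve H {{u, v}}"
  proof -
    obtain e where e: "e \<in> edges H" "uedge e = {u, v}" using 1 by (auto simp: uedges_def)
    have "{e' \<in> edges H. uedge e' \<in> {{u, v}}} = {e}" using e inj_uedge by (auto simp: inj_on_def)
    then have c: "curve H {{u, v}} = path_image (drawing H e)" by (simp add: curve_def)
    from e(2) consider "fst e = u" "snd e = v" | "fst e = v" "snd e = u" by (auto simp: doubleton_eq_iff)
    then show ?thesis
    proof cases
      case 1 then show ?thesis using drawing_arc[OF e(1)] c by auto
    next
      case 2 then show ?thesis using drawing_arc[OF e(1)] c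
        by (intro exI[of _ "reversepath (drawing H e)"]) (auto simp: arc_reversepath)
    qed
  qed
  then obtain g1 where g1: "arc g1" "pathstart g1 = u" "pathfinish g1 = v" "path_image g1 = curve H {{u, v}}"
    by blast
  show ?case
  proof (cases vs)
    case Nil then show ?thesis using single by simp
  next
    case (Cons w ws)
    obtain g2 where g2: "arc g2" "pathstart g2 = v" "pathfinish g2 = last (v # vs)"
      "path_image g2 = curve H (set (walk_edges (v # vs)))"
      using 1 Cons by auto
    have n: "{u, v} \<notin> set (walk_edges (v # vs))"
      using walk_edges_subset[of "{u, v}" "v # vs"] 1 by auto
    have U: "\<Union> (set (walk_edges (v # vs))) = set (v # vs)" using Union_walk_edges[of "v # vs"] Cons by simp
    have "path_image g1 \<inter> path_image g2 = \<Union> {{u, v}} \<inter> \<Union> (set (walk_edges (v # vs)))"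
      unfolding g1 g2 using 1 n by (intro curve_Int) auto
    also have "\<dots> = {v}" unfolding U using 1 by auto
    finally have "arc (g1 +++ g2)" using g1 g2 by (intro arc_join) auto
    moreover have "path_image (g1 +++ g2) = curve H (set (walk_edges (u # v # vs)))"
      using g1 g2 curve_Un[of H "{{u, v}}" "set (walk_edges (v # vs))"] by (simp add: path_image_join)
    ultimately show ?thesis using g1 g2 Cons by (intro exI[of _ "g1 +++ g2"]) simp
  qed
qed auto

lemma walk_parity:
  assumes "vs \<noteq> []" "set (walk_edges vs) \<subseteq> uedges H"
  shows "(hd vs \<in> black H \<longleftrightarrow> last vs \<in> black H) \<longleftrightarrow> odd (length vs)"
  using assms
proof (induction vs rule: walk_edges.induct)
  case (1 u v vs)
  then have "u \<in> black H \<longleftrightarrow> v \<notin> black H"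
    using edge_ends colours_disjoint by (auto simp: mem_uedges) fastforce+
  then show ?case using 1 by auto
qed auto

lemma even_cycle: "cycle_in (uedges H) vs \<Longrightarrow> even (length vs)"
  using walk_parity[of "vs @ [hd vs]"] by (cases vs) (auto simp: cycle_in_def)

text \<open>
  The value that the Kasteleyn class has to take on a cycle.
\<close>

definition kasteleyn_sign :: "complex list \<Rightarrow> bit" where
  "kasteleyn_sign vs = of_nat (interior_vertices H vs + length vs div 2 + 1)"

lemma kasteleyn_sign_cong:
  assumes "set (cycle_edges vs) = set (cycle_edges ws)" "length vs = length ws" "vs \<noteq> []"
  shows "kasteleyn_sign vs = kasteleyn_sign ws"
proof -
  have "ws \<noteq> []" using assms by auto
  then show ?thesis using assms by (simp add: kasteleyn_sign_def interior_vertices_def cycle_curve_conv)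
qed

text \<open>
  This is the planar heart of the existence of the Kasteleyn class: the three paths of a theta graph
  are drawn as three arcs that meet only in their ends, so that \<open>theta_card_inside\<close> counts the interior
  vertices, and the bipartition makes the lengths of the cycles even.
\<close>

sublocale theta_additive "uedges H" kasteleyn_sign
proof
  show "finite (uedges H)" using finite_edges by (simp add: uedges_def)
  show "kasteleyn_sign (y @ x) = kasteleyn_sign (x @ y)" if "cycle_in (uedges H) (x @ y)" for x y
    using that by (intro kasteleyn_sign_cong cycle_edges_rotate) (auto simp: cycle_in_def)
  show "kasteleyn_sign (rev vs) = kasteleyn_sign vs" if "cycle_in (uedges H) vs" for vs
    using that by (intro kasteleyn_sign_cong cycle_edges_rev) (auto simp: cycle_in_def)
  fix a b x y z
  assume xy: "cycle_in (uedges H) (a # x @ b # rev y)" and yz: "cycle_in (uedges H) (a # y @ b # rev z)"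
    and xz: "cycle_in (uedges H) (a # x @ b # rev z)"
  let ?W = "\<lambda>x. set (walk_edges (a # x @ [b]))"
  have sub: "?W x \<subseteq> uedges H" "?W y \<subseteq> uedges H" "?W z \<subseteq> uedges H"
    using xy yz unfolding cycle_in_def theta_cycle_edges by auto
  have U: "\<Union> (?W x) = set (a # x @ [b])" for x using Union_walk_edges[of "a # x @ [b]"] by simp
  have d: "distinct (a # x @ [b])" "distinct (a # y @ [b])" "distinct (a # z @ [b])"
    "set x \<inter> set y = {}" "set x \<inter> set z = {}" "set y \<inter> set z = {}"
    using xy yz xz by (auto simp: cycle_in_def)
  obtain gx where gx: "arc gx" "pathstart gx = a" "pathfinish gx = b" "path_image gx = curve H (?W x)"
    using walk_arc[of "a # x @ [b]"] d sub by auto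
  obtain gy where gy: "arc gy" "pathstart gy = a" "pathfinish gy = b" "path_image gy = curve H (?W y)"
    using walk_arc[of "a # y @ [b]"] d sub by auto
  obtain gz where gz: "arc gz" "pathstart gz = a" "pathfinish gz = b" "path_image gz = curve H (?W z)"
    using walk_arc[of "a # z @ [b]"] d sub by auto
  have i: "path_image gx \<inter> path_image gy = {a, b}" "path_image gx \<inter> path_image gz = {a, b}"
    "path_image gy \<inter> path_image gz = {a, b}"
    using curve_Int[OF sub(1,2) theta_walks_disjoint[OF xy]] curve_Int[OF sub(1,3) theta_walks_disjoint[OF xz]]
      curve_Int[OF sub(2,3) theta_walks_disjoint[OF yz]] d
    unfolding gx(4) gy(4) gz(4) U by auto
  let ?N = "\<lambda>g g'. card (verts H \<inter> inside (path_image g \<union> path_image g'))"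
  let ?n = "\<lambda>g. card (verts H \<inter> (path_image g - {a, b}))"
  have n: "card (verts H \<inter> (curve H (?W x) - {a, b})) = length x"
    if "?W x \<subseteq> uedges H" "distinct (a # x @ [b])" for x
  proof -
    have "verts H \<inter> (curve H (?W x) - {a, b}) = set (a # x @ [b]) - {a, b}"
      using curve_verts[OF that(1)] unfolding U by blast
    also have "\<dots> = set x" using that(2) by auto
    finally show ?thesis using that(2) by (simp add: distinct_card)
  qed
  have N: "interior_vertices H (a # x @ b # rev y) = ?N gx gy"
    "interior_vertices H (a # x @ b # rev z) = ?N gx gz"
    "interior_vertices H (a # y @ b # rev z) = ?N gy gz"
    unfolding gx gy gz by (simp_all only: interior_vertices_def cycle_curve_conv theta_cycle_edges curve_Un list.simps simp_thms)
  have len: "even (length x + length y)" "even (length x + length z)" "even (length y + length z)"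
    using even_cycle[OF xy] even_cycle[OF xz] even_cycle[OF yz] by simp_all
  have "?N gx gy = ?N gx gz + ?N gy gz + ?n gz \<or> ?N gx gz = ?N gx gy + ?N gy gz + ?n gy \<or>
    ?N gy gz = ?N gx gy + ?N gx gz + ?n gx"
    by (rule theta_card_inside[OF gx(1-3) gy(1-3) gz(1-3) i finite_verts])
  then have "?N gx gy = ?N gx gz + ?N gy gz + length z \<or> ?N gx gz = ?N gx gy + ?N gy gz + length y \<or>
    ?N gy gz = ?N gx gy + ?N gx gz + length x"
    unfolding gx(4) gy(4) gz(4) using n sub d by simp
  then have par: "even ((?N gx gy + (length x + length y + 2) div 2 + 1) + (?N gx gz + (length x + length z + 2) div 2 + 1)
    + (?N gy gz + (length y + length z + 2) div 2 + 1))"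
    by (rule theta_count_parity[OF len])
  have bit: "of_bool (odd n2) = (of_bool (odd n1) + of_bool (odd n3) :: bit)" if "even (n1 + n2 + n3)" for n1 n2 n3 :: nat
    using that by auto
  have l: "length (a # x @ b # rev y) = length x + length y + 2" for x y by simp
  show "kasteleyn_sign (a # x @ b # rev z) = kasteleyn_sign (a # x @ b # rev y) + kasteleyn_sign (a # y @ b # rev z)"
    unfolding kasteleyn_sign_def N of_nat_bit_parity l by (rule bit[OF par])
qed

end

section \<open>Existence and uniqueness of the Kasteleyn class\<close>

lemma sum_list_differences:
  fixes g :: "'a \<Rightarrow> 'b::ab_group_add"
  assumes "length xs = length ys"
  shows "(\<Sum>(p, q)\<leftarrow>zip xs ys. g q - g p) = (\<Sum>q\<leftarrow>ys. g q) - (\<Sum>p\<leftarrow>xs. g p)"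
  using assms by (induction xs ys rule: list_induct2) (auto simp: algebra_simps)

lemma sum_cycle_steps:
  assumes "distinct vs"
  shows "(\<Sum>s\<in>cycle_steps vs. \<phi> s) = (\<Sum>s\<leftarrow>zip vs (rotate1 vs). \<phi> s)"
  unfolding cycle_steps_def using assms by (intro sum_list_distinct_conv_sum_set[symmetric] distinct_zipI1) auto

text \<open>
  The last vertex of a longest path has its successor on the path.
\<close>

lemma successor_relation_has_cycle:
  assumes "finite V" "x \<in> V" and succ: "\<And>v. v \<in> V \<Longrightarrow> \<exists>w\<in>V. R v w"
  obtains vs where "vs \<noteq> []" "distinct vs" "set vs \<subseteq> V" "\<forall>(u, v)\<in>cycle_steps vs. R u v"
proof -
  let ?P = "\<lambda>vs. vs \<noteq> [] \<and> distinct vs \<and> set vs \<subseteq> V \<and> (\<forall>(u, v)\<in>set (zip vs (tl vs)). R u v)"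
  have bound: "length vs \<le> card V" if "?P vs" for vs
    using that distinct_card[of vs] card_mono[OF assms(1), of "set vs"] by simp
  have "?P [x]" using assms(2) by simp
  then have "\<exists>vs. ?P vs \<and> (\<forall>ws. ?P ws \<longrightarrow> length ws \<le> length vs)"
    by (rule ex_has_greatest_nat[of ?P _ length "Suc (card V)"]) (use bound in \<open>simp add: less_Suc_eq_le\<close>)
  then obtain vs where vs: "?P vs" and max: "\<And>ws. ?P ws \<Longrightarrow> length ws \<le> length vs"
    by (elim exE conjE) (rule that, intro conjI, assumption+, blast)
  have "last vs \<in> V" using vs last_in_set by blast
  then obtain w where w: "w \<in> V" "R (last vs) w" using succ by blast
  have zip_snoc: "set (zip (us @ [w]) (tl (us @ [w]))) = set (zip us (tl us)) \<union> {(last us, w)}" if "us \<noteq> []" for us and w :: 'a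
    using that by (induction us rule: walk_edges.induct) auto
  have "w \<in> set vs"
  proof (rule ccontr)
    assume "w \<notin> set vs"
    then have "?P (vs @ [w])" using vs w zip_snoc[of vs w] by (auto simp del: tl_append2)
    from max[OF this] show False by simp
  qed
  then obtain xs ys where xy: "vs = xs @ w # ys" by (meson split_list)
  let ?c = "w # ys"
  have "set (zip ?c (tl ?c)) \<subseteq> set (zip vs (tl vs))"
  proof -
    have "set (zip us (tl us)) \<subseteq> set (zip (ts @ us) (tl (ts @ us)))" for ts us :: "'a list"
    proof (induction ts)
      case (Cons t ts)
      then show ?case by (cases "ts @ us") auto
    qed simp
    then show ?thesis unfolding xy .
  qed
  moreover have "cycle_steps ?c = set (zip ?c (tl ?c)) \<union> {(last ?c, w)}"
  proof -
    have "zip (?c @ [w]) (rotate1 ?c) = zip ?c (rotate1 ?c)" by (simp add: zip_append1 del: append_Cons)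
    then show ?thesis using zip_snoc[of ?c w] by (simp add: cycle_steps_def)
  qed
  ultimately have "\<forall>(u, v)\<in>cycle_steps ?c. R u v" using vs w(2) xy by auto
  then show ?thesis using that[of ?c] vs xy by auto
qed

lemma pairing_add:
  fixes \<kappa> :: "'e \<Rightarrow> 'r::ring_1"
  shows "(\<Sum>e\<in>E. of_int (c e + d e) * \<kappa> e) = (\<Sum>e\<in>E. of_int (c e) * \<kappa> e) + (\<Sum>e\<in>E. of_int (d e) * \<kappa> e)"
  by (simp add: distrib_right sum.distrib)

context bipartite_plane_graph
begin

lemma boundary_add: "boundary H (\<lambda>e. c e + d e) v = boundary H c v + boundary H d v"
  by (simp add: boundary_def distrib_right sum.distrib)

lemma boundary_diff: "boundary H (\<lambda>e. c e - d e) v = boundary H c v - boundary H d v"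
  by (simp add: boundary_def left_diff_distrib sum_subtractf)

lemma H1_add: "c \<in> H1 H \<Longrightarrow> d \<in> H1 H \<Longrightarrow> (\<lambda>e. c e + d e) \<in> H1 H"
  by (simp add: H1_def boundary_add)

lemma H1_diff: "c \<in> H1 H \<Longrightarrow> d \<in> H1 H \<Longrightarrow> (\<lambda>e. c e - d e) \<in> H1 H"
  by (simp add: H1_def boundary_diff)

text \<open>
  Pairing an antisymmetric function with the chain of a cycle sums it along the oriented cycle.
  Applied to differences of a function of the ends it shows that the chain is closed. Over
  \<open>\<int>/(2)\<close> every symmetric function is antisymmetric, which evaluates classes given by edge weights.
\<close>

lemma sum_cycle_chain:
  fixes \<phi> :: "complex \<times> complex \<Rightarrow> 'a::comm_ring_1"
  assumes vs: "is_cycle H vs" and anti: "\<And>s. \<phi> (prod.swap s) = - \<phi> s"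
  shows "(\<Sum>e\<in>edges H. of_int (cycle_chain H vs e) * \<phi> e) = (\<Sum>s\<leftarrow>zip vs (rotate1 vs). \<phi> s)"
proof -
  let ?S = "cycle_steps vs"
  have S: "?S = {e \<in> edges H. e \<in> ?S} \<union> prod.swap ` {e \<in> edges H. prod.swap e \<in> ?S}"
    using vs unfolding is_cycle_def by force
  have disj: "{e \<in> edges H. e \<in> ?S} \<inter> prod.swap ` {e \<in> edges H. prod.swap e \<in> ?S} = {}"
    using edge_asym by auto
  have "(\<Sum>s\<leftarrow>zip vs (rotate1 vs). \<phi> s) = (\<Sum>s\<in>?S. \<phi> s)"
    using vs by (simp add: is_cycle_def sum_cycle_steps)
  also have "\<dots> = (\<Sum>s\<in>{e \<in> edges H. e \<in> ?S}. \<phi> s) + (\<Sum>s\<in>prod.swap ` {e \<in> edges H. prod.swap e \<in> ?S}. \<phi> s)"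
    using finite_edges disj by (subst S, subst sum.union_disjoint) auto
  also have "(\<Sum>s\<in>prod.swap ` {e \<in> edges H. prod.swap e \<in> ?S}. \<phi> s) = (\<Sum>e\<in>{e \<in> edges H. prod.swap e \<in> ?S}. - \<phi> e)"
    by (subst sum.reindex) (auto simp: anti inj_on_def)
  also have "(\<Sum>s\<in>{e \<in> edges H. e \<in> ?S}. \<phi> s) + \<dots> =
    (\<Sum>e\<in>edges H. (if e \<in> ?S then \<phi> e else 0) + (if prod.swap e \<in> ?S then - \<phi> e else 0))"
    using finite_edges by (simp only: sum.distrib sum.inter_filter)
  also have "\<dots> = (\<Sum>e\<in>edges H. of_int (cycle_chain H vs e) * \<phi> e)"
    by (intro sum.cong) (auto simp: cycle_chain_def)
  finally show ?thesis by simp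
qed

lemma cycle_chain_in_H1:
  assumes "is_cycle H vs" shows "cycle_chain H vs \<in> H1 H"
proof -
  have "boundary H (cycle_chain H vs) v = 0" for v
  proof -
    let ?g = "\<lambda>u. if u = v then 1 else 0 :: int"
    have "boundary H (cycle_chain H vs) v = (\<Sum>s\<leftarrow>zip vs (rotate1 vs). ?g (snd s) - ?g (fst s))"
      unfolding boundary_def using sum_cycle_chain[OF assms, of "\<lambda>s. ?g (snd s) - ?g (fst s)"] by simp
    also have "\<dots> = (\<Sum>u\<leftarrow>rotate1 vs. ?g u) - (\<Sum>u\<leftarrow>vs. ?g u)"
      using sum_list_differences[of vs "rotate1 vs" ?g] by (simp add: case_prod_unfold)
    also have "\<dots> = 0" by (cases vs) auto
    finally show ?thesis .
  qed
  then show ?thesis by (simp add: H1_def cycle_chain_def)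
qed

text \<open>
  Read the chain as a flow that runs along or against each edge according to the sign of the coefficient. As the flow is
  closed, it leaves every vertex that it enters, so it runs around some cycle. No edge
  carries flow in both directions, hence the cycle has length at least 3.
\<close>

lemma closed_chain_contains_cycle:
  assumes "c \<in> H1 H" "e0 \<in> edges H" "c e0 \<noteq> 0"
  obtains vs where "is_cycle H vs" "\<exists>e\<in>edges H. cycle_chain H vs e \<noteq> 0"
    "\<And>e. cycle_chain H vs e \<noteq> 0 \<Longrightarrow> cycle_chain H vs e = sgn (c e)"
proof -
  define R where "R p q \<longleftrightarrow> ((p, q) \<in> edges H \<and> c (p, q) > 0) \<or> ((q, p) \<in> edges H \<and> c (q, p) < 0)" for p q
  define V where "V = {q. \<exists>p. R p q}"
  have VH: "V \<subseteq> verts H" using edge_ends by (fastforce simp: V_def R_def verts_def)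
  have succ: "\<exists>w\<in>V. R v w" if v: "v \<in> V" for v
  proof (rule ccontr)
    assume "\<not> ?thesis"
    then have no: "\<not> R v w" for w by (auto simp: V_def)
    obtain p where p: "R p v" using v by (auto simp: V_def)
    let ?t = "\<lambda>e. c e * ((if snd e = v then 1 else 0) - (if fst e = v then 1 else 0))"
    have nn: "0 \<le> ?t e" if "e \<in> edges H" for e
      using no[of "snd e"] no[of "fst e"] that edge_neq[of "fst e" "snd e"]
      by (cases e) (auto simp: R_def not_less mult_le_0_iff)
    obtain e where e: "e \<in> edges H" "0 < ?t e"
    proof -
      from p show ?thesis unfolding R_def
      proof
        assume "(p, v) \<in> edges H \<and> c (p, v) > 0"
        then show ?thesis using that[of "(p, v)"] edge_neq by auto
      next
        assume "(v, p) \<in> edges H \<and> c (v, p) < 0"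
        then show ?thesis using that[of "(v, p)"] edge_neq[of v p] by (auto simp: mult_neg_neg)
      qed
    qed
    have "0 < (\<Sum>e\<in>edges H. ?t e)"
      using e nn finite_edges by (intro sum_pos2[of _ e]) auto
    then show False using assms(1) v VH by (auto simp: H1_def boundary_def)
  qed
  have "\<exists>x. x \<in> V"
  proof (cases "c e0 > 0")
    case True then show ?thesis using assms(2) by (cases e0) (auto simp: V_def R_def)
  next
    case False then show ?thesis using assms(2,3) by (cases e0) (force simp: V_def R_def)
  qed
  then obtain x where "x \<in> V" by blast
  then obtain vs where vs: "vs \<noteq> []" "distinct vs" "\<forall>(u, v)\<in>cycle_steps vs. R u v"
    using successor_relation_has_cycle[OF finite_subset[OF VH finite_verts], of x R] succ by metis
  have asym: "\<not> R q p" if "R p q" for p q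
    using that edge_asym[of p q] edge_asym[of q p] by (auto simp: R_def)
  have "3 \<le> length vs"
  proof (rule ccontr)
    assume "\<not> 3 \<le> length vs"
    then obtain a b where "vs = [a] \<or> vs = [a, b]"
      using vs(1) by (cases vs rule: walk_edges.cases) (auto simp: Suc_le_eq)
    then show False using vs(3) asym[of a a] asym[of a b] by (auto simp: cycle_steps_def)
  qed
  then have cyc: "is_cycle H vs" using vs by (auto simp: is_cycle_def R_def)
  moreover have "cycle_chain H vs e = sgn (c e)" if "cycle_chain H vs e \<noteq> 0" for e
  proof -
    have e: "e \<in> edges H" using that by (auto simp: cycle_chain_def split: if_splits)
    obtain p q where pq: "e = (p, q)" by (cases e)
    have "R p q" if "(p, q) \<in> cycle_steps vs" using vs(3) that by auto
    moreover have "R q p" if "(q, p) \<in> cycle_steps vs" using vs(3) that by auto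
    ultimately show ?thesis
      using that e edge_asym[of p q] edge_asym[of q p] asym[of p q] unfolding pq cycle_chain_def
      by (auto simp: R_def split: if_splits)
  qed
  moreover have "\<exists>e\<in>edges H. cycle_chain H vs e \<noteq> 0"
  proof -
    obtain u v where uv: "(u, v) \<in> cycle_steps vs"
    proof -
      have "zip vs (rotate1 vs) \<noteq> []" using vs(1) by (cases vs) auto
      then have "hd (zip vs (rotate1 vs)) \<in> cycle_steps vs" unfolding cycle_steps_def by (rule hd_in_set)
      then show ?thesis using that by (metis surj_pair)
    qed
    then have "(v, u) \<notin> cycle_steps vs" "R u v" using vs(3) asym by blast+
    then show ?thesis using uv edge_asym
      by (auto simp: R_def cycle_chain_def intro: bexI[of _ "(u, v)"] bexI[of _ "(v, u)"])
  qed
  ultimately show ?thesis using that by blast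
qed

text \<open>
  Graph cycles generate \<open>H\<^sub>1\<close>: subtracting a cycle contained in a closed chain decreases the sum
  of the absolute values of the coefficients.
\<close>

lemma Cohomology1_eqI:
  fixes k k' :: "chain \<Rightarrow> 'r::ab_group_add"
  assumes k: "k \<in> Cohomology1 H" "k' \<in> Cohomology1 H"
    and eq: "\<And>vs. is_cycle H vs \<Longrightarrow> k (cycle_chain H vs) = k' (cycle_chain H vs)"
  shows "k = k'"
proof
  fix c
  have "k c = k' c" if "c \<in> H1 H" using that
  proof (induction "nat (\<Sum>e\<in>edges H. \<bar>c e\<bar>)" arbitrary: c rule: less_induct)
    case less
    show ?case
    proof (cases "\<exists>e\<in>edges H. c e \<noteq> 0")
      case False
      then have "c e = 0" for e using less.prems unfolding H1_def by blast
      then have c0: "c = (\<lambda>e. 0)" by (rule ext)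
      have zero: "f (\<lambda>e. 0) = 0" if f: "f \<in> Cohomology1 H" for f :: "chain \<Rightarrow> 'r"
      proof -
        have "f (\<lambda>e. c e + c e) = f c + f c" using f less.prems unfolding Cohomology1_def by blast
        then show ?thesis by (simp add: c0)
      qed
      then show ?thesis using zero[OF k(1)] zero[OF k(2)] c0 by simp
    next
      case True
      then obtain vs where vs: "is_cycle H vs" and nz: "\<exists>e\<in>edges H. cycle_chain H vs e \<noteq> 0"
        and sg: "\<And>e. cycle_chain H vs e \<noteq> 0 \<Longrightarrow> cycle_chain H vs e = sgn (c e)"
        using closed_chain_contains_cycle[OF less.prems] by metis
      let ?z = "cycle_chain H vs" 
      define d where "d = (\<lambda>e. c e - ?z e)"
      have d: "d \<in> H1 H" unfolding d_def by (intro H1_diff less.prems cycle_chain_in_H1 vs)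
      have le: "\<bar>d e\<bar> \<le> \<bar>c e\<bar> \<and> (?z e \<noteq> 0 \<longrightarrow> \<bar>d e\<bar> < \<bar>c e\<bar>)" for e
        using sg[of e] by (cases "?z e = 0") (auto simp: d_def sgn_if split: if_splits)
      have "(\<Sum>e\<in>edges H. \<bar>d e\<bar>) < (\<Sum>e\<in>edges H. \<bar>c e\<bar>)"
        using le nz finite_edges by (intro sum_strict_mono_ex1) auto
      moreover have "0 \<le> (\<Sum>e\<in>edges H. \<bar>d e\<bar>)" by (rule sum_nonneg) simp
      ultimately have IH: "k d = k' d" by (intro less.hyps[of d] d) linarith
      have split: "f c = f d + f ?z" if f: "f \<in> Cohomology1 H" for f :: "chain \<Rightarrow> 'r"
      proof -
        have "f (\<lambda>e. d e + ?z e) = f d + f ?z"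
          using f d cycle_chain_in_H1[OF vs] unfolding Cohomology1_def by blast
        then show ?thesis by (simp add: d_def)
      qed
      show ?thesis using split[OF k(1)] split[OF k(2)] IH eq[OF vs] by simp
    qed
  qed
  then show "k c = k' c" using k unfolding Cohomology1_def by (cases "c \<in> H1 H") auto
qed

theorem kasteleyn_class_exists:
  "\<exists>k::chain \<Rightarrow> bit. k \<in> Cohomology1 H \<and>
    (\<forall>vs. is_cycle H vs \<longrightarrow> k (cycle_chain H vs) = of_nat (interior_vertices H vs + length vs div 2 + 1))"
proof -
  obtain \<kappa> where \<kappa>: "\<And>vs. cycle_in (uedges H) vs \<Longrightarrow> kasteleyn_sign vs = weight \<kappa> (vs @ [hd vs])"
    using sum_of_edge_weights by blast
  define k :: "chain \<Rightarrow> bit" where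
    "k c = (if c \<in> H1 H then \<Sum>e\<in>edges H. of_int (c e) * \<kappa> (uedge e) else 0)" for c
  have "k \<in> Cohomology1 H"
    unfolding Cohomology1_def k_def using H1_add pairing_add[of _ _ "\<lambda>e. \<kappa> (uedge e)" "edges H"] by (simp del: of_int_add)
  moreover have "k (cycle_chain H vs) = kasteleyn_sign vs" if vs: "is_cycle H vs" for vs
  proof -
    have ne: "vs \<noteq> []" using vs by (auto simp: is_cycle_def)
    have "k (cycle_chain H vs) = (\<Sum>s\<leftarrow>zip vs (rotate1 vs). \<kappa> (uedge s))"
      using cycle_chain_in_H1[OF vs] sum_cycle_chain[OF vs, of "\<lambda>s. \<kappa> (uedge s)"]
      by (simp add: k_def insert_commute)
    also have "\<dots> = weight \<kappa> (vs @ [hd vs])"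
      by (simp add: cycle_edges_conv[OF ne] case_prod_unfold o_def)
    also have "\<dots> = kasteleyn_sign vs" using \<kappa> vs by (simp add: is_cycle_iff)
    finally show ?thesis .
  qed
  ultimately show ?thesis unfolding kasteleyn_sign_def by blast
qed

theorem kasteleyn_class:
  "kasteleyn_class H \<in> Cohomology1 H"
  "is_cycle H vs \<Longrightarrow> kasteleyn_class H (cycle_chain H vs) = of_nat (interior_vertices H vs + length vs div 2 + 1)"
proof -
  have "\<exists>!k::chain \<Rightarrow> bit. k \<in> Cohomology1 H \<and>
    (\<forall>vs. is_cycle H vs \<longrightarrow> k (cycle_chain H vs) = of_nat (interior_vertices H vs + length vs div 2 + 1))"
    using kasteleyn_class_exists by (rule ex_ex1I) (auto intro!: Cohomology1_eqI)
  from theI'[OF this] show "kasteleyn_class H \<in> Cohomology1 H"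
    "is_cycle H vs \<Longrightarrow> kasteleyn_class H (cycle_chain H vs) = of_nat (interior_vertices H vs + length vs div 2 + 1)"
    unfolding kasteleyn_class_def by blast+
qed

end

section \<open>The Kasteleyn class and signs of permutations\<close>

lemma zip_interleave:
  "set (zip (concat (map (\<lambda>(i, j). [a i, b j]) ps)) (concat (map (\<lambda>(i, j). [b j, a j]) ps))) =
    (\<Union>(i, j)\<in>set ps. {(a i, b j), (b j, a j)})"
  by (induction ps) auto

lemma tl_interleave:
  "tl (concat (map (\<lambda>(i, j). [a i, b j]) (zip (i # is) (is @ [x])))) @ [a x] =
    concat (map (\<lambda>(i, j). [b j, a j]) (zip (i # is) (is @ [x])))"
proof (induction "is" arbitrary: i)
  case (Cons j "is")
  let ?L = "concat (map (\<lambda>(i, j). [a i, b j]) (zip (j # is) (is @ [x])))"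
  have "?L = a j # tl ?L" by (cases "is") simp_all
  then have "?L @ [a x] = a j # (tl ?L @ [a x])" by (metis append_Cons)
  then show ?case unfolding Cons.IH by simp
qed simp

lemma cycle_steps_interleave:
  assumes "cs \<noteq> []"
  shows "cycle_steps (concat (map (\<lambda>(i, j). [a i, b j]) (zip cs (rotate1 cs)))) =
    (\<Union>(i, j)\<in>set (zip cs (rotate1 cs)). {(a i, b j), (b j, a j)})"
proof -
  obtain i "is" where cs: "cs = i # is" using assms by (cases cs) auto
  let ?vs = "concat (map (\<lambda>(i, j). [a i, b j]) (zip cs (rotate1 cs)))"
  have "?vs \<noteq> []" "hd ?vs = a i" unfolding cs by (cases "is"; simp)+
  then have "rotate1 ?vs = tl ?vs @ [a i]" by (simp add: rotate1_hd_tl)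
  also have "\<dots> = concat (map (\<lambda>(i, j). [b j, a j]) (zip cs (rotate1 cs)))"
    unfolding cs using tl_interleave[of a b i "is" i] by simp
  finally show ?thesis unfolding cycle_steps_def by (simp only: zip_interleave)
qed

lemma sign_cycle_of_list:
  "distinct cs \<Longrightarrow> cs \<noteq> [] \<Longrightarrow> sign (cycle_of_list cs) = (-1) ^ (length cs - 1)"
proof (induction cs rule: cycle_of_list.induct)
  case (1 i j cs)
  have "sign (cycle_of_list (i # j # cs)) = sign (Transposition.transpose i j) * sign (cycle_of_list (j # cs))"
    unfolding cycle_of_list.simps(1) by (rule sign_compose[OF permutation_swap_id permutation_of_cycle])
  moreover have "sign (cycle_of_list (j # cs)) = (-1) ^ length cs" using 1 by simp
  moreover have "sign (Transposition.transpose i j) = -1" using 1 by (simp add: sign_swap_id)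
  ultimately have "sign (cycle_of_list (i # j # cs)) = -1 * (-1) ^ length cs" by (simp only:)
  then show ?case by (simp only: list.size diff_Suc_1 add_Suc_right add_0_right power_Suc)
qed auto

lemma finite_cycle_decomp: "cycle_decomp I \<sigma> \<Longrightarrow> \<sigma> permutes I \<and> finite I"
proof (induction rule: cycle_decomp.induct)
  case (comp I p cs)
  have "p permutes (set cs \<union> I)" using comp.IH by (auto intro: permutes_subset)
  moreover have "cycle_of_list cs permutes (set cs \<union> I)" using cycle_permutes by (rule permutes_subset) simp
  ultimately have "(cycle_of_list cs \<circ> p) permutes (set cs \<union> I)" by (rule permutes_compose)
  moreover have "finite (set cs \<union> I)" using comp.IH by simp
  ultimately show ?case by (rule conjI)
qed (auto simp: permutes_empty)

text \<open>
  A plane graph with a matching. The index set \<open>I\<close> numbers the edges of the matching, hence both the white and the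
  black vertices; a second matching is then a permutation of \<open>I\<close>.
\<close>

locale matched_plane_graph = bipartite_plane_graph +
  fixes I :: "'i set" and \<omega> \<phi> :: "'i \<Rightarrow> complex"
  assumes finite_I: "finite I"
    and \<omega>: "inj_on \<omega> I" "\<omega> ` I = white H"
    and \<phi>: "inj_on \<phi> I" "\<phi> ` I = black H"
    and matched: "\<And>i. i \<in> I \<Longrightarrow> (\<phi> i, \<omega> i) \<in> edges H"
begin

text \<open>
  The closed chain \<open>\<mu>' - \<mu>\<close>, where \<open>\<mu>\<close> is the given matching and \<open>\<mu>'\<close> matches \<open>\<omega> i\<close> with
  \<open>\<phi> (\<sigma> i)\<close>. As a sum over \<open>I\<close> it is additive for permutations with disjoint supports.
\<close>

definition permuted_difference :: "('i \<Rightarrow> 'i) \<Rightarrow> chain" where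
  "permuted_difference \<sigma> e = (\<Sum>i\<in>I. (if e = (\<phi> (\<sigma> i), \<omega> i) then 1 else 0) - (if e = (\<phi> i, \<omega> i) then 1 else 0))"

lemma permuted_difference_id: "permuted_difference id = (\<lambda>e. 0)"
  by (simp add: fun_eq_iff permuted_difference_def)

lemma permuted_difference_in_H1:
  assumes \<sigma>: "\<sigma> permutes I" and e: "\<And>i. i \<in> I \<Longrightarrow> (\<phi> (\<sigma> i), \<omega> i) \<in> edges H"
  shows "permuted_difference \<sigma> \<in> H1 H"
proof -
  have "boundary H (permuted_difference \<sigma>) v = 0" for v
  proof -
    let ?t = "\<lambda>e. (if snd e = v then 1 else 0) - (if fst e = v then 1 else 0) :: int"
    have pick: "(\<Sum>e\<in>edges H. (if e = e' then 1 else 0) * ?t e) = ?t e'" if "e' \<in> edges H" for e'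
    proof -
      have "(\<Sum>e\<in>edges H. (if e = e' then 1 else 0) * ?t e) = (\<Sum>e\<in>edges H. if e = e' then ?t e else 0)"
        by (intro sum.cong) auto
      then show ?thesis using that finite_edges by (simp only: sum.delta if_True)
    qed
    have "boundary H (permuted_difference \<sigma>) v =
      (\<Sum>e\<in>edges H. \<Sum>i\<in>I. (if e = (\<phi> (\<sigma> i), \<omega> i) then 1 else 0) * ?t e - (if e = (\<phi> i, \<omega> i) then 1 else 0) * ?t e)"
      unfolding boundary_def permuted_difference_def sum_distrib_right left_diff_distrib ..
    also have "\<dots> = (\<Sum>i\<in>I. \<Sum>e\<in>edges H. (if e = (\<phi> (\<sigma> i), \<omega> i) then 1 else 0) * ?t e - (if e = (\<phi> i, \<omega> i) then 1 else 0) * ?t e)"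
      by (rule sum.swap)
    also have "\<dots> = (\<Sum>i\<in>I. ?t (\<phi> (\<sigma> i), \<omega> i) - ?t (\<phi> i, \<omega> i))"
      using e matched by (intro sum.cong refl) (simp only: sum_subtractf pick)
    also have "\<dots> = (\<Sum>i\<in>I. if \<phi> i = v then 1 else 0) - (\<Sum>i\<in>I. if \<phi> (\<sigma> i) = v then 1 else 0)"
      by (simp add: sum_subtractf[symmetric])
    also have "(\<Sum>i\<in>I. if \<phi> (\<sigma> i) = v then 1 else 0 :: int) = (\<Sum>i\<in>I. if \<phi> i = v then 1 else 0)"
      using sum.permute[OF \<sigma>, of "\<lambda>i. if \<phi> i = v then 1 else 0 :: int"] by (simp add: o_def)
    finally show ?thesis by simp
  qed
  moreover have "permuted_difference \<sigma> e' = 0" if "e' \<notin> edges H" for e'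
    unfolding permuted_difference_def using that e matched by (intro sum.neutral) auto
  ultimately show ?thesis by (simp add: H1_def)
qed

text \<open>
  An edge with both ends off a cycle does not meet its curve, and it is connected.
\<close>

lemma matched_same_side:
  assumes vs: "is_cycle H vs" and i: "i \<in> I" and off: "\<omega> i \<notin> set vs" "\<phi> i \<notin> set vs"
  shows "\<omega> i \<in> inside (cycle_curve H vs) \<longleftrightarrow> \<phi> i \<in> inside (cycle_curve H vs)"
proof -
  have ne: "vs \<noteq> []" and len: "2 \<le> length (vs @ [hd vs])" using vs by (auto simp: is_cycle_def)
  let ?S = "set (cycle_edges vs)"
  have U: "\<Union>?S = set vs" using Union_walk_edges[OF len] ne by auto
  have S: "?S \<subseteq> uedges H" using vs by (simp add: is_cycle_iff cycle_in_def)
  have e: "{\<phi> i, \<omega> i} \<in> uedges H" using matched[OF i] by (simp add: mem_uedges)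
  have "{{\<phi> i, \<omega> i}} \<inter> ?S = {}" using U off by auto
  then have "curve H {{\<phi> i, \<omega> i}} \<inter> curve H ?S = \<Union>{{\<phi> i, \<omega> i}} \<inter> \<Union>?S"
    using e S by (intro curve_Int) auto
  also have "\<dots> = {}" unfolding U using off by auto
  finally have disj: "curve H {{\<phi> i, \<omega> i}} \<subseteq> - cycle_curve H vs"
    unfolding cycle_curve_conv[OF ne] by blast
  obtain g where g: "arc g" "pathstart g = \<phi> i" "pathfinish g = \<omega> i" "path_image g = curve H {{\<phi> i, \<omega> i}}"
    using walk_arc[of "[\<phi> i, \<omega> i]"] e edge_neq[OF matched[OF i]] by auto
  have "\<phi> i \<in> path_image g" "\<omega> i \<in> path_image g"
    using g pathstart_in_path_image[of g] pathfinish_in_path_image[of g] by simp_all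
  moreover have "connected (path_image g)" by (rule connected_path_image[OF arc_imp_path[OF g(1)]])
  ultimately have "connected_component (- cycle_curve H vs) (\<phi> i) (\<omega> i)"
    unfolding connected_component_def using disj g(4) by blast
  then show ?thesis using inside_same_component connected_component_sym by metis
qed

text \<open>
  If the matching pairs the vertices of the cycle among themselves, then it also pairs the vertices
  inside.
\<close>

lemma even_interior:
  assumes vs: "is_cycle H vs" and J: "J \<subseteq> I" "set vs = \<omega> ` J \<union> \<phi> ` J"
  shows "even (interior_vertices H vs)"
proof -
  let ?C = "cycle_curve H vs"
  have len: "2 \<le> length (vs @ [hd vs])" and ne: "vs \<noteq> []" using vs by (auto simp: is_cycle_def)
  have on: "set vs \<subseteq> ?C"
  proof -
    have "\<Union>(set (cycle_edges vs)) = set vs" using Union_walk_edges[OF len] ne by auto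
    moreover have "set (cycle_edges vs) \<subseteq> uedges H" using vs by (simp add: is_cycle_iff cycle_in_def)
    ultimately show ?thesis using curve_verts[of "set (cycle_edges vs)"] unfolding cycle_curve_conv[OF ne] by blast
  qed
  have no: "inside ?C \<inter> set vs = {}" using on by (auto simp: inside_def)
  define K where "K = {i \<in> I. \<omega> i \<in> inside ?C}"
  have same: "\<omega> i \<in> inside ?C \<longleftrightarrow> \<phi> i \<in> inside ?C" if i: "i \<in> I" for i
  proof (cases "i \<in> J")
    case True then show ?thesis using no J(2) by blast
  next
    case False
    have "\<omega> i \<notin> \<omega> ` J" "\<phi> i \<notin> \<phi> ` J"
      using False inj_on_image_mem_iff[OF \<omega>(1) i J(1)] inj_on_image_mem_iff[OF \<phi>(1) i J(1)] by simp_all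
    moreover have "\<omega> i \<in> white H" "\<phi> i \<in> black H" "\<omega> ` J \<subseteq> white H" "\<phi> ` J \<subseteq> black H"
      using i J(1) unfolding \<omega>(2)[symmetric] \<phi>(2)[symmetric] by blast+
    ultimately have "\<omega> i \<notin> set vs" "\<phi> i \<notin> set vs"
      unfolding J(2) Un_iff using colours_disjoint by (meson subsetD)+
    then show ?thesis by (rule matched_same_side[OF vs i])
  qed
  have "\<omega> ` I \<inter> inside ?C = \<omega> ` K" by (auto simp: K_def)
  moreover have "\<phi> ` I \<inter> inside ?C = \<phi> ` K" using same by (auto simp: K_def)
  ultimately have "verts H \<inter> inside ?C = \<omega> ` K \<union> \<phi> ` K"
    unfolding verts_def \<omega>(2)[symmetric] \<phi>(2)[symmetric] Int_Un_distrib2 by (rule arg_cong2)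
  moreover have "\<omega> ` K \<inter> \<phi> ` K = {}"
  proof -
    have "\<omega> ` K \<subseteq> white H" "\<phi> ` K \<subseteq> black H"
      unfolding \<omega>(2)[symmetric] \<phi>(2)[symmetric] K_def by blast+
    then show ?thesis using colours_disjoint by fast
  qed
  moreover have "finite K" "K \<subseteq> I" using finite_I by (auto simp: K_def)
  ultimately have "interior_vertices H vs = card K + card K"
    using card_image[OF inj_on_subset[OF \<omega>(1)]] card_image[OF inj_on_subset[OF \<phi>(1)]]
    by (simp add: interior_vertices_def card_Un_disjoint)
  then show ?thesis by simp
qed

abbreviation "k \<equiv> kasteleyn_class H"

lemma class_add: "c \<in> H1 H \<Longrightarrow> d \<in> H1 H \<Longrightarrow> k (\<lambda>e. c e + d e) = k c + k d"
  using kasteleyn_class(1) unfolding Cohomology1_def by blast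

lemma zero_in_H1: "(\<lambda>e. 0) \<in> H1 H"
  by (simp add: H1_def boundary_def)

lemma class_zero: "k (\<lambda>e. 0) = 0"
  using class_add[OF zero_in_H1 zero_in_H1] by (cases "k (\<lambda>e. 0)") auto

text \<open>
  For \<open>cs = [i\<^sub>1, \<dots>, i\<^sub>l]\<close> with \<open>l \<ge> 2\<close> the vertices \<open>\<omega> i\<^sub>1, \<phi> i\<^sub>2, \<omega> i\<^sub>2, \<phi> i\<^sub>3, \<dots>, \<omega> i\<^sub>l, \<phi> i\<^sub>1\<close> form a cycle, and
  the difference of the matchings is the chain of this cycle up to sign. The number of interior vertices being even, both sides
  are \<open>l + 1\<close> modulo 2.
\<close>

lemma kasteleyn_class_of_cyclic_permutation:
  assumes cs: "distinct cs" "set cs \<subseteq> I"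
    and e: "\<And>i. i \<in> set cs \<Longrightarrow> (\<phi> (cycle_of_list cs i), \<omega> i) \<in> edges H"
  shows "k (permuted_difference (cycle_of_list cs)) = of_bool (sign (cycle_of_list cs) = -1)"
proof -
  let ?\<sigma> = "cycle_of_list cs"
  consider "cs = []" | x where "cs = [x]" | "2 \<le> length cs"
    by (cases cs rule: walk_edges.cases) auto
  then show ?thesis
  proof cases
    case 3
    define vs where "vs = concat (map (\<lambda>(i, j). [\<omega> i, \<phi> j]) (zip cs (rotate1 cs)))"
    have ne: "cs \<noteq> []" using 3 by auto
    have "rotate1 cs = map ?\<sigma> cs" using cyclic_rotation[OF cs(1), of 1] by simp
    then have ps: "set (zip cs (rotate1 cs)) = (\<lambda>i. (i, ?\<sigma> i)) ` set cs"
      by (simp add: zip_map2 zip_same_conv_map)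
    have steps: "cycle_steps vs = (\<Union>i\<in>set cs. {(\<omega> i, \<phi> (?\<sigma> i)), (\<phi> (?\<sigma> i), \<omega> (?\<sigma> i))})"
      unfolding vs_def cycle_steps_interleave[OF ne] ps by auto
    have \<sigma>cs: "?\<sigma> ` set cs = set cs" by (rule cycle_is_surj[OF cs(1)])
    have "length (concat (map (\<lambda>(i, j). [\<omega> i, \<phi> j]) ps)) = 2 * length ps" for ps
      by (induction ps) auto
    then have len: "length vs = 2 * length cs" by (simp add: vs_def)
    have "set vs = (\<Union>p\<in>set (zip cs (rotate1 cs)). {\<omega> (fst p), \<phi> (snd p)})"
      unfolding vs_def by (auto simp: case_prod_unfold)
    also have "\<dots> = \<omega> ` set cs \<union> \<phi> ` ?\<sigma> ` set cs" unfolding ps by auto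
    finally have set_vs: "set vs = \<omega> ` set cs \<union> \<phi> ` set cs" unfolding \<sigma>cs .
    have "\<omega> ` set cs \<inter> \<phi> ` set cs = {}" using cs(2) \<omega>(2) \<phi>(2) colours_disjoint by blast
    then have "card (set vs) = length vs"
      unfolding set_vs len using cs card_image[OF inj_on_subset[OF \<omega>(1) cs(2)]]
        card_image[OF inj_on_subset[OF \<phi>(1) cs(2)]] distinct_card[OF cs(1)]
      by (simp add: card_Un_disjoint)
    then have "distinct vs" by (rule card_distinct)
    have cyc: "is_cycle H vs"
    proof -
      have "?\<sigma> i \<in> I" if "i \<in> set cs" for i using that \<sigma>cs cs(2) by blast
      then show ?thesis unfolding is_cycle_def steps using e matched \<open>distinct vs\<close> 3 len by simp
    qed
    have inj\<omega>: "\<omega> i = \<omega> j \<longleftrightarrow> i = j" if "i \<in> I" "j \<in> I" for i j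
      using \<omega>(1) that by (auto simp: inj_on_def)
    have \<sigma>id: "?\<sigma> i = i" if "i \<notin> set cs" for i using that by (rule id_outside_supp)
    have neg: "permuted_difference ?\<sigma> d = - cycle_chain H vs d" for d
    proof (cases "d \<in> edges H")
      case False
      then show ?thesis unfolding permuted_difference_def cycle_chain_def
        using e matched \<sigma>id by (subst sum.neutral) (auto, metis+)
    next
      case True
      obtain b w where d: "d = (b, w)" by (cases d)
      then have bw: "b \<in> black H" "w \<in> white H" using edge_ends[OF True] by auto
      then obtain i where i: "i \<in> I" "w = \<omega> i" using \<omega>(2) by blast
      have "permuted_difference ?\<sigma> d = (\<Sum>j\<in>I. if j = i then (if b = \<phi> (?\<sigma> i) then 1 else 0) - (if b = \<phi> i then 1 else 0) else 0)"
        unfolding permuted_difference_def d i(2) using inj\<omega>[OF i(1)] by (intro sum.cong) auto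
      then have pd: "permuted_difference ?\<sigma> d = (if b = \<phi> (?\<sigma> i) then 1 else 0) - (if b = \<phi> i then 1 else 0)"
        using i(1) finite_I by simp
      have wb: "\<omega> j \<noteq> b" "\<phi> j \<noteq> w" if "j \<in> I" for j using that bw \<omega>(2) \<phi>(2) colours_disjoint by blast+
      have "d \<in> cycle_steps vs \<longleftrightarrow> (\<exists>j\<in>set cs. b = \<phi> (?\<sigma> j) \<and> w = \<omega> (?\<sigma> j))"
        unfolding steps d using wb cs(2) by auto
      also have "\<dots> \<longleftrightarrow> (\<exists>j\<in>?\<sigma> ` set cs. b = \<phi> j \<and> w = \<omega> j)" by simp
      also have "\<dots> \<longleftrightarrow> i \<in> set cs \<and> b = \<phi> i" unfolding \<sigma>cs i(2) using inj\<omega>[OF i(1)] cs(2) by auto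
      finally have 1: "d \<in> cycle_steps vs \<longleftrightarrow> i \<in> set cs \<and> b = \<phi> i" .
      have "prod.swap d \<in> cycle_steps vs \<longleftrightarrow> (\<exists>j\<in>set cs. b = \<phi> (?\<sigma> j) \<and> w = \<omega> j)"
      proof -
        have "\<phi> (?\<sigma> j) \<noteq> w" if "j \<in> set cs" for j using that \<sigma>cs cs(2) wb(2) by blast
        then show ?thesis unfolding steps d by auto
      qed
      also have "\<dots> \<longleftrightarrow> i \<in> set cs \<and> b = \<phi> (?\<sigma> i)" unfolding i(2) using inj\<omega>[OF i(1)] cs(2) by auto
      finally have 2: "prod.swap d \<in> cycle_steps vs \<longleftrightarrow> i \<in> set cs \<and> b = \<phi> (?\<sigma> i)" .
      show ?thesis using True \<sigma>id[of i] by (cases "i \<in> set cs") (simp_all add: pd cycle_chain_def 1 2)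
    qed
    have "k (permuted_difference ?\<sigma>) + k (cycle_chain H vs) = k (\<lambda>d. permuted_difference ?\<sigma> d + cycle_chain H vs d)"
    proof (intro class_add[symmetric] cycle_chain_in_H1[OF cyc])
      have "(\<lambda>d. 0 - cycle_chain H vs d) \<in> H1 H" by (intro H1_diff zero_in_H1 cycle_chain_in_H1 cyc)
      moreover have "permuted_difference ?\<sigma> = (\<lambda>d. 0 - cycle_chain H vs d)" using neg by auto
      ultimately show "permuted_difference ?\<sigma> \<in> H1 H" by simp
    qed
    also have "\<dots> = 0" using neg class_zero by simp
    finally have "k (permuted_difference ?\<sigma>) = k (cycle_chain H vs)"
      by (cases "k (cycle_chain H vs)"; cases "k (permuted_difference ?\<sigma>)") simp_all
    also have "\<dots> = of_bool (odd (interior_vertices H vs + length cs + 1))"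
      unfolding kasteleyn_class(2)[OF cyc] len of_nat_bit_parity by simp
    also have "\<dots> = of_bool (even (length cs))"
      using even_interior[OF cyc cs(2) set_vs] by simp
    also have "even (length cs) \<longleftrightarrow> sign ?\<sigma> = -1"
      using sign_cycle_of_list[OF cs(1) ne] 3 by (cases "length cs") (auto simp: minus_one_power_iff)
    finally show ?thesis .
  qed (auto simp: permuted_difference_id class_zero)
qed

lemma kasteleyn_class_of_cycle_decomp:
  assumes "cycle_decomp J \<sigma>" "J \<subseteq> I" "\<And>i. i \<in> J \<Longrightarrow> (\<phi> (\<sigma> i), \<omega> i) \<in> edges H"
  shows "k (permuted_difference \<sigma>) = of_bool (sign \<sigma> = -1)"
  using assms
proof (induction rule: cycle_decomp.induct)
  case empty
  then show ?case unfolding permuted_difference_id class_zero by simp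
next
  case (comp J p cs)
  let ?c = "cycle_of_list cs"
  have p: "p permutes J" "finite J" using finite_cycle_decomp[OF comp(1)] by auto
  have c: "?c permutes set cs" by (rule cycle_permutes)
  have pJ: "(?c \<circ> p) i = p i" "?c i = i" if "i \<in> J" for i
    using that comp.hyps permutes_in_image[OF p(1), of i] id_outside_supp[of _ cs] by auto
  have nJ: "(?c \<circ> p) i = ?c i" "p i = i" if "i \<notin> J" for i
    using that p(1) by (auto simp: permutes_def)
  have J: "J \<subseteq> I" "set cs \<subseteq> I" using comp.prems by auto
  have e1: "(\<phi> (p i), \<omega> i) \<in> edges H" if "i \<in> J" for i
    using comp.prems(2)[of i] pJ[OF that] that by auto
  have e2: "(\<phi> (?c i), \<omega> i) \<in> edges H" if "i \<in> set cs" for i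
  proof -
    have "i \<notin> J" using that comp.hyps by blast
    then show ?thesis using comp.prems(2)[of i] nJ(1)[of i] that by auto
  qed
  have "permuted_difference (?c \<circ> p) = (\<lambda>e. permuted_difference p e + permuted_difference ?c e)"
    unfolding permuted_difference_def sum.distrib[symmetric]
  proof (intro ext sum.cong refl)
    fix e i assume "i \<in> I"
    let ?z = "\<lambda>x. (if e = (\<phi> x, \<omega> i) then 1 else 0 :: int)"
    show "?z ((?c \<circ> p) i) - ?z i = ?z (p i) - ?z i + (?z (?c i) - ?z i)"
      using pJ[of i] nJ[of i] by (cases "i \<in> J") simp_all
  qed
  moreover have "permuted_difference p \<in> H1 H"
    using p(1) J e1 matched nJ by (intro permuted_difference_in_H1 permutes_subset[of p J I]) metis+
  moreover have "permuted_difference ?c \<in> H1 H"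
    using J e2 matched id_outside_supp[of _ cs]
    by (intro permuted_difference_in_H1 permutes_subset[OF c]) metis+
  ultimately have "k (permuted_difference (?c \<circ> p)) = k (permuted_difference p) + k (permuted_difference ?c)"
    using class_add by simp
  also have "\<dots> = of_bool (sign p = -1) + of_bool (sign ?c = -1)"
    using comp.IH[OF J(1) e1] kasteleyn_class_of_cyclic_permutation[OF comp.hyps(2) J(2) e2] by simp
  also have "\<dots> = of_bool (sign (?c \<circ> p) = -1)"
  proof -
    have "permutation p" using p permutation_permutes by blast
    then have "sign (?c \<circ> p) = sign ?c * sign p" by (simp add: sign_compose permutation_of_cycle)
    then show ?thesis by (cases p rule: sign_cases; cases ?c rule: sign_cases) auto
  qed
  finally show ?case .
qed

theorem kasteleyn_class_of_permutation:
  assumes "\<sigma> permutes I" "\<And>i. i \<in> I \<Longrightarrow> (\<phi> (\<sigma> i), \<omega> i) \<in> edges H"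
  shows "k (permuted_difference \<sigma>) = of_bool (sign \<sigma> = -1)"
  using kasteleyn_class_of_cycle_decomp[OF cycle_decomposition[OF assms(1) finite_I]] assms(2) by auto

end

section \<open>Coefficients of the characteristic polynomial\<close>

text \<open>
  Outside the chosen set \<open>I\<close> the diagonal entries \<open>t\<close> are taken, which requires the permutation to
  fix the complement of \<open>I\<close>.
\<close>

lemma prod_diagonal_sum_permutes:
  fixes t :: "'a::comm_ring_1" and M :: "'i \<Rightarrow> 'i \<Rightarrow> 'a"
  assumes U: "finite U" "p permutes U"
  shows "(\<Prod>i\<in>U. (if i = p i then t else 0) - M i (p i)) =
    (\<Sum>I\<in>{I \<in> Pow U. p permutes I}. t ^ card (U - I) * ((-1) ^ card I * (\<Prod>i\<in>I. M i (p i))))"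
proof -
  have "(\<Prod>i\<in>U. (if i = p i then t else 0) - M i (p i)) =
    (\<Prod>i\<in>U. - M i (p i) + (if i = p i then t else 0))" by simp
  also have "\<dots> = (\<Sum>I\<in>Pow U. (\<Prod>i\<in>I. - M i (p i)) * (\<Prod>i\<in>U - I. if i = p i then t else 0))"
    using U(1) by (rule prod_add)
  also have "\<dots> = (\<Sum>I\<in>{I \<in> Pow U. p permutes I}. (\<Prod>i\<in>I. - M i (p i)) * (\<Prod>i\<in>U - I. if i = p i then t else 0))"
  proof (intro sum.mono_neutral_right ballI)
    fix I assume I: "I \<in> Pow U - {I \<in> Pow U. p permutes I}"
    have "\<exists>i\<in>U - I. i \<noteq> p i"
      using I permutes_superset[OF U(2), of I] by force
    then have "(\<Prod>i\<in>U - I. if i = p i then t else 0) = 0"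
      using U(1) by (intro prod_zero) auto
    then show "(\<Prod>i\<in>I. - M i (p i)) * (\<Prod>i\<in>U - I. if i = p i then t else 0) = 0" by simp
  qed (use U in auto)
  also have "\<dots> = (\<Sum>I\<in>{I \<in> Pow U. p permutes I}. t ^ card (U - I) * ((-1) ^ card I * (\<Prod>i\<in>I. M i (p i))))"
  proof (rule sum.cong)
    fix I assume I: "I \<in> {I \<in> Pow U. p permutes I}"
    then have fixed: "p i = i" if "i \<in> U - I" for i using that by (auto simp: permutes_def)
    then have "(\<Prod>i\<in>U - I. if i = p i then t else 0) = (\<Prod>i\<in>U - I. t)" by (intro prod.cong) auto
    then have "(\<Prod>i\<in>U - I. if i = p i then t else 0) = t ^ card (U - I)" by simp
    moreover have "(\<Prod>i\<in>I. - M i (p i)) = (-1) ^ card I * (\<Prod>i\<in>I. M i (p i))"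
      by (rule prod_uminus)
    ultimately show "(\<Prod>i\<in>I. - M i (p i)) * (\<Prod>i\<in>U - I. if i = p i then t else 0) =
      t ^ card (U - I) * ((-1) ^ card I * (\<Prod>i\<in>I. M i (p i)))" by (simp add: mult.commute)
  qed simp
  finally show ?thesis .
qed

theorem coeff_char_poly:
  fixes M :: "'a::comm_ring_1 Matrix.mat"
  assumes M: "M \<in> carrier_mat n n" and m: "m \<le> n"
  shows "poly.coeff (char_poly M) (n - m) =
    (-1) ^ m * (\<Sum>I | I \<subseteq> {0..<n} \<and> card I = m. \<Sum>p | p permutes I. of_int (sign p) * (\<Prod>i\<in>I. M $$ (i, p i)))"
proof -
  let ?U = "{0..<n}" and ?X = "[:0, 1:] :: 'a poly"
  let ?t = "\<lambda>I p. (-1) ^ card I * (of_int (sign p) * (\<Prod>i\<in>I. M $$ (i, p i)))"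
  have carrier: "char_poly_matrix M \<in> carrier_mat n n" using M by simp
  have "char_poly M = (\<Sum>p | p permutes ?U. of_int (sign p) * (\<Prod>i\<in>?U. char_poly_matrix M $$ (i, p i)))"
    unfolding char_poly_def by (rule det_def'[OF carrier])
  also have "\<dots> = (\<Sum>p | p permutes ?U. of_int (sign p) * (\<Prod>i\<in>?U. (if i = p i then ?X else 0) - [:M $$ (i, p i):]))"
  proof (intro sum.cong refl arg_cong2[where f = "(*)"] prod.cong)
    fix p i assume "p \<in> {p. p permutes ?U}" "i \<in> ?U"
    then have "i < n" "p i < n" using permutes_in_image[of p ?U i] by auto
    then show "char_poly_matrix M $$ (i, p i) = (if i = p i then ?X else 0) - [:M $$ (i, p i):]"
      using M by (simp add: char_poly_matrix_def)
  qed
  also have "\<dots> = (\<Sum>p | p permutes ?U. \<Sum>I\<in>{I \<in> Pow ?U. p permutes I}. 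
      of_int (sign p) * (?X ^ card (?U - I) * ((-1) ^ card I * (\<Prod>i\<in>I. [:M $$ (i, p i):]))))"
    using prod_diagonal_sum_permutes[of ?U _ ?X "\<lambda>i j. [:M $$ (i, j):]"]
    by (intro sum.cong refl) (simp only: finite_atLeastLessThan mem_Collect_eq sum_distrib_left)
  also have "\<dots> = (\<Sum>I\<in>Pow ?U. \<Sum>p\<in>{p. p permutes ?U \<and> p permutes I}.
      of_int (sign p) * (?X ^ card (?U - I) * ((-1) ^ card I * (\<Prod>i\<in>I. [:M $$ (i, p i):]))))"
    by (subst sum.swap_restrict) (auto simp: finite_permutations)
  also have "\<dots> = (\<Sum>I\<in>Pow ?U. \<Sum>p | p permutes I. monom (?t I p) (n - card I))"
  proof (intro sum.cong)
    fix I assume I: "I \<in> Pow ?U"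
    show "{p. p permutes ?U \<and> p permutes I} = {p. p permutes I}"
      using I permutes_subset by auto
    fix p :: "nat \<Rightarrow> nat"
    have X: "?X ^ k = monom 1 k" for k by (simp add: monom_altdef)
    have s: "(of_int (sign p) :: 'a poly) = [:of_int (sign p):]" by (cases p rule: sign_cases) (simp_all add: one_pCons)
    have P: "(\<Prod>i\<in>I. [:M $$ (i, p i):]) = [:\<Prod>i\<in>I. M $$ (i, p i):]"
      by (induction I rule: infinite_finite_induct) (auto simp: one_pCons)
    have pw: "((-1) ^ k :: 'a poly) = [:(-1) ^ k:]" for k by (induction k) (auto simp: one_pCons)
    have "card (?U - I) = n - card I" using I finite_subset[of I ?U] by (subst card_Diff_subset) auto
    then show "of_int (sign p) * (?X ^ card (?U - I) * ((-1) ^ card I * (\<Prod>i\<in>I. [:M $$ (i, p i):]))) =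
      monom (?t I p) (n - card I)"
      unfolding X s P pw by (simp add: smult_monom ac_simps)
  qed simp
  finally have "poly.coeff (char_poly M) (n - m) =
    (\<Sum>I\<in>Pow ?U. \<Sum>p | p permutes I. if n - card I = n - m then ?t I p else 0)"
    by (simp add: coeff_sum)
  also have "\<dots> = (\<Sum>I\<in>Pow ?U. if card I = m then \<Sum>p | p permutes I. ?t I p else 0)"
  proof (intro sum.cong refl)
    fix I assume "I \<in> Pow ?U"
    then have "card I \<le> n" using card_mono[of ?U I] by simp
    then have "n - card I = n - m \<longleftrightarrow> card I = m" using m by linarith
    then show "(\<Sum>p | p permutes I. if n - card I = n - m then ?t I p else 0) =
      (if card I = m then \<Sum>p | p permutes I. ?t I p else 0)" by simp
  qed
  also have "\<dots> = (\<Sum>I\<in>{I \<in> Pow ?U. card I = m}. \<Sum>p | p permutes I. ?t I p)"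
    by (rule sum.inter_filter[symmetric]) simp
  also have "\<dots> = (-1) ^ m * (\<Sum>I | I \<subseteq> {0..<n} \<and> card I = m. \<Sum>p | p permutes I. of_int (sign p) * (\<Prod>i\<in>I. M $$ (i, p i)))"
    unfolding sum_distrib_left by (intro sum.cong) auto
  finally show ?thesis .
qed

text \<open>
  Composing \<open>\<sigma>\<close> with the transposition of two points that \<open>f\<close> identifies changes only the sign.
\<close>

lemma alternating_sum_noninjective:
  fixes Y :: "'i \<Rightarrow> 'j \<Rightarrow> 'a::{idom, ring_char_0}"
  assumes I: "finite I" and f: "\<not> inj_on f I"
  shows "(\<Sum>\<sigma> | \<sigma> permutes I. of_int (sign \<sigma>) * (\<Prod>i\<in>I. Y i (f (\<sigma> i)))) = 0"
proof -
  obtain a b where ab: "a \<in> I" "b \<in> I" "a \<noteq> b" "f a = f b" using f by (auto simp: inj_on_def)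
  let ?\<tau> = "Transposition.transpose a b" and ?F = "\<lambda>\<sigma>. of_int (sign \<sigma>) * (\<Prod>i\<in>I. Y i (f (\<sigma> i)))"
  have \<tau>: "?\<tau> permutes I" using ab permutes_swap_id by fast
  have f\<tau>: "f (?\<tau> x) = f x" for x using ab by (simp add: Transposition.transpose_def)
  have "(\<Sum>\<sigma> | \<sigma> permutes I. ?F \<sigma>) = (\<Sum>\<sigma> | \<sigma> permutes I. ?F (?\<tau> \<circ> \<sigma>))"
    by (rule setum_permutations_compose_left[OF \<tau>])
  also have "\<dots> = (\<Sum>\<sigma> | \<sigma> permutes I. - ?F \<sigma>)"
  proof (intro sum.cong refl)
    fix \<sigma> assume "\<sigma> \<in> {\<sigma>. \<sigma> permutes I}"
    then have "permutation \<sigma>" using I permutation_permutes by blast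
    then have "sign (?\<tau> \<circ> \<sigma>) = - sign \<sigma>"
      using ab by (simp add: sign_compose permutation_swap_id sign_swap_id)
    then show "?F (?\<tau> \<circ> \<sigma>) = - ?F \<sigma>" by (simp add: f\<tau>)
  qed
  also have "\<dots> = - (\<Sum>\<sigma> | \<sigma> permutes I. ?F \<sigma>)" by (simp add: sum_negf)
  finally show ?thesis by (simp only: eq_neg_iff_add_eq_0 mult_2[symmetric] mult_eq_0_iff) simp
qed

text \<open>
  The Cauchy-Binet formula for a principal minor, left unfactored: instead of a product of two minors
  for each image \<open>J\<close> of \<open>f\<close>, the right-hand side keeps the sum over pairs \<open>(f, f \<circ> \<sigma>)\<close> of bijections from
  \<open>I\<close> to \<open>J\<close>. These become the pairs of matchings.
\<close>

theorem minor_of_product: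
  fixes X Y :: "'i \<Rightarrow> 'j \<Rightarrow> complex"
  assumes I: "finite I" and B: "finite B"
  shows "(\<Sum>p | p permutes I. of_int (sign p) * (\<Prod>i\<in>I. \<Sum>k\<in>B. X i k * Y (p i) k)) =
    (\<Sum>f\<in>{f \<in> I \<rightarrow>\<^sub>E B. inj_on f I}. \<Sum>\<sigma> | \<sigma> permutes I.
      of_int (sign \<sigma>) * ((\<Prod>i\<in>I. X i (f i)) * (\<Prod>i\<in>I. Y i (f (\<sigma> i)))))"
proof -
  let ?T = "\<lambda>f \<sigma>. of_int (sign \<sigma>) * ((\<Prod>i\<in>I. X i (f i)) * (\<Prod>i\<in>I. Y i (f (\<sigma> i))))"
  have "(\<Sum>p | p permutes I. of_int (sign p) * (\<Prod>i\<in>I. \<Sum>k\<in>B. X i k * Y (p i) k)) =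
    (\<Sum>p | p permutes I. \<Sum>f\<in>I \<rightarrow>\<^sub>E B. of_int (sign p) * ((\<Prod>i\<in>I. X i (f i)) * (\<Prod>i\<in>I. Y (p i) (f i))))"
    using I B by (simp add: prod_sum_PiE sum_distrib_left prod.distrib)
  also have "\<dots> = (\<Sum>f\<in>I \<rightarrow>\<^sub>E B. \<Sum>p | p permutes I. of_int (sign p) * ((\<Prod>i\<in>I. X i (f i)) * (\<Prod>i\<in>I. Y (p i) (f i))))"
    by (rule sum.swap)
  also have "\<dots> = (\<Sum>f\<in>I \<rightarrow>\<^sub>E B. \<Sum>\<sigma> | \<sigma> permutes I. ?T f \<sigma>)"
  proof (rule sum.cong[OF refl])
    fix f
    have "(\<Sum>p | p permutes I. of_int (sign p) * ((\<Prod>i\<in>I. X i (f i)) * (\<Prod>i\<in>I. Y (p i) (f i)))) =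
      (\<Sum>p | p permutes I. ?T f (Hilbert_Choice.inv p))"
    proof (intro sum.cong refl)
      fix p assume "p \<in> {p. p permutes I}"
      then have p: "p permutes I" by simp
      have "(\<Prod>i\<in>I. Y i (f (Hilbert_Choice.inv p i))) = (\<Prod>i\<in>I. Y (p i) (f (Hilbert_Choice.inv p (p i))))"
        by (subst prod.permute[OF p]) (simp add: o_def)
      also have "\<dots> = (\<Prod>i\<in>I. Y (p i) (f i))" by (simp add: permutes_inverses(2)[OF p])
      finally show "of_int (sign p) * ((\<Prod>i\<in>I. X i (f i)) * (\<Prod>i\<in>I. Y (p i) (f i))) = ?T f (Hilbert_Choice.inv p)"
        using p I permutation_permutes[of p] by (auto simp: sign_inverse)
    qed
    also have "\<dots> = (\<Sum>\<sigma> | \<sigma> permutes I. ?T f \<sigma>)" by (rule sum_permutations_inverse[symmetric])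
    finally show "(\<Sum>p | p permutes I. of_int (sign p) * ((\<Prod>i\<in>I. X i (f i)) * (\<Prod>i\<in>I. Y (p i) (f i)))) =
      (\<Sum>\<sigma> | \<sigma> permutes I. ?T f \<sigma>)" .
  qed
  also have "\<dots> = (\<Sum>f\<in>{f \<in> I \<rightarrow>\<^sub>E B. inj_on f I}. \<Sum>\<sigma> | \<sigma> permutes I. ?T f \<sigma>)"
  proof (intro sum.mono_neutral_right ballI)
    fix f assume f: "f \<in> (I \<rightarrow>\<^sub>E B) - {f \<in> I \<rightarrow>\<^sub>E B. inj_on f I}"
    then have "(\<Sum>\<sigma> | \<sigma> permutes I. of_int (sign \<sigma>) * (\<Prod>i\<in>I. Y i (f (\<sigma> i)))) = 0"
      using I by (intro alternating_sum_noninjective) auto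
    moreover have "(\<Sum>\<sigma> | \<sigma> permutes I. ?T f \<sigma>) =
      (\<Prod>i\<in>I. X i (f i)) * (\<Sum>\<sigma> | \<sigma> permutes I. of_int (sign \<sigma>) * (\<Prod>i\<in>I. Y i (f (\<sigma> i))))"
      by (simp add: sum_distrib_left ac_simps)
    ultimately show "(\<Sum>\<sigma> | \<sigma> permutes I. ?T f \<sigma>) = 0" by simp
  qed (use I B in \<open>auto intro: finite_PiE\<close>)
  finally show ?thesis .
qed

lemma coeff_singular_polynomial:
  assumes A: "A \<in> carrier_mat n n'" and m: "m \<le> n"
  shows "poly.coeff (singular_polynomial A) (n - m) = (-1) ^ m *
    (\<Sum>I | I \<subseteq> {0..<n} \<and> card I = m. \<Sum>f\<in>{f \<in> I \<rightarrow>\<^sub>E {0..<n'}. inj_on f I}. \<Sum>\<sigma> | \<sigma> permutes I.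
      of_int (sign \<sigma>) * ((\<Prod>i\<in>I. A $$ (i, f i)) * (\<Prod>i\<in>I. cnj (A $$ (i, f (\<sigma> i))))))"
proof -
  have AA: "A * mat_adjoint A \<in> carrier_mat n n" using A by (simp add: mat_adjoint_def mat_of_rows_def)
  have entry: "(A * mat_adjoint A) $$ (i, j) = (\<Sum>k\<in>{0..<n'}. A $$ (i, k) * cnj (A $$ (j, k)))"
    if "i < n" "j < n" for i j
    using that A by (simp add: scalar_prod_def mat_adjoint_def mat_of_rows_def)
  have "(\<Sum>p | p permutes I. of_int (sign p) * (\<Prod>i\<in>I. (A * mat_adjoint A) $$ (i, p i))) =
     (\<Sum>p | p permutes I. of_int (sign p) * (\<Prod>i\<in>I. \<Sum>k\<in>{0..<n'}. A $$ (i, k) * cnj (A $$ (p i, k))))"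
    if "I \<subseteq> {0..<n}" for I
  proof (intro sum.cong refl arg_cong2[where f = "(*)"] prod.cong)
    fix p i assume "p \<in> {p. p permutes I}" "i \<in> I"
    then have "i < n" "p i < n" using permutes_in_image[of p I i] that by auto
    then show "(A * mat_adjoint A) $$ (i, p i) = (\<Sum>k\<in>{0..<n'}. A $$ (i, k) * cnj (A $$ (p i, k)))"
      by (rule entry)
  qed
  then have minor: "(\<Sum>p | p permutes I. of_int (sign p) * (\<Prod>i\<in>I. (A * mat_adjoint A) $$ (i, p i))) =
    (\<Sum>f\<in>{f \<in> I \<rightarrow>\<^sub>E {0..<n'}. inj_on f I}. \<Sum>\<sigma> | \<sigma> permutes I.
      of_int (sign \<sigma>) * ((\<Prod>i\<in>I. A $$ (i, f i)) * (\<Prod>i\<in>I. cnj (A $$ (i, f (\<sigma> i))))))"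
    if "I \<subseteq> {0..<n}" for I
    using minor_of_product[of I "{0..<n'}" "\<lambda>i k. A $$ (i, k)" "\<lambda>i k. cnj (A $$ (i, k))"]
      finite_subset[OF that finite_atLeastLessThan] that by (simp only: finite_atLeastLessThan simp_thms)
  show ?thesis
    unfolding singular_polynomial_def coeff_char_poly[OF AA m]
    by (subst sum.cong[OF refl minor]) simp_all
qed

section \<open>The circle group and induced subgraphs\<close>

lemma \<eta>_circle: "\<eta> (circle r) = cis (2 * pi * r)"
  by (simp add: \<eta>.abs_eq cis_conv_exp mult.commute mult.left_commute)

lemma circle_cases: obtains r where "x = circle r"
  by (metis Quotient_abs_rep Quotient_circle)

lemma \<eta>_add: "\<eta> (x + y) = \<eta> x * \<eta> y"
  by (cases x rule: circle_cases; cases y rule: circle_cases)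
    (simp add: plus_circle.abs_eq \<eta>_circle cis_mult distrib_left)

lemma \<eta>_zero: "\<eta> 0 = 1"
  by (simp add: zero_circle_def \<eta>_circle)

lemma \<eta>_sum: "\<eta> (\<Sum>i\<in>I. x i) = (\<Prod>i\<in>I. \<eta> (x i))"
  by (induction I rule: infinite_finite_induct) (simp_all add: \<eta>_zero \<eta>_add)

lemma \<eta>_uminus: "\<eta> (- x) = cnj (\<eta> x)"
  by (cases x rule: circle_cases) (simp add: uminus_circle.abs_eq \<eta>_circle cis_cnj)

lemma \<eta>_diff: "\<eta> (x - y) = \<eta> x * cnj (\<eta> y)"
  using \<eta>_add[of x "- y"] by (simp add: \<eta>_uminus)

lemma \<eta>_half: "\<eta> (half b) = (if b = 1 then -1 else 1)"
  by (simp add: half_def \<eta>_circle)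

lemma \<eta>_inject: "\<eta> x = \<eta> y \<longleftrightarrow> x = y"
proof
  assume eq: "\<eta> x = \<eta> y"
  obtain r s where rs: "x = circle r" "y = circle s" by (metis circle_cases)
  have "\<eta> (x - y) = 1" using eq \<eta>_add[of y "- y"] by (simp add: \<eta>_diff \<eta>_uminus \<eta>_zero)
  then have "cis (2 * pi * (r - s)) = 1" by (simp add: rs minus_circle.abs_eq \<eta>_circle)
  then have "cos (2 * pi * (r - s)) = 1" by (simp add: complex_eq_iff)
  then obtain k :: int where "2 * pi * (r - s) = of_int k * 2 * pi" using cos_one_2pi_int by blast
  then have "r - s = of_int k" by simp
  then show "x = y" unfolding rs circle.abs_eq_iff int_congruent_def by simp
qed simp

lemma \<eta>_surj: "cmod z = 1 \<Longrightarrow> \<exists>x. \<eta> x = z"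
  using \<eta>_circle[of "Arg z / (2 * pi)"] cis_Arg[of z] by (cases "z = 0") (auto simp: sgn_eq)

lemma int_scale_simps: "int_scale 0 x = 0" "int_scale 1 x = x"
  "int_scale (k - l) x = int_scale k x - int_scale l x"
  by (transfer, simp add: int_congruent_def left_diff_distrib)+

lemma bipartite_plane_graph_induced:
  assumes "bipartite_plane_graph G" shows "bipartite_plane_graph (induced_subgraph G U)"
proof -
  interpret bipartite_plane_graph G by fact
  let ?H = "induced_subgraph G U"
  have e: "e \<in> edges G \<and> fst e \<in> verts ?H \<and> snd e \<in> verts ?H" if "e \<in> edges ?H" for e
    using that edge_ends[of e] by (auto simp: induced_subgraph_def verts_def)
  have sub: "verts ?H \<subseteq> verts G" by (auto simp: induced_subgraph_def verts_def)
  have dr: "drawing ?H = drawing G" by (simp add: induced_subgraph_def)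
  have "path_image (drawing G e) \<inter> verts ?H = {fst e, snd e}" if "e \<in> edges ?H" for e
    using e[OF that] drawing_arc(4)[of e] sub by blast
  moreover have "path_image (drawing G e) \<inter> path_image (drawing G e') \<subseteq> verts ?H"
    if "e \<in> edges ?H" "e' \<in> edges ?H" "e \<noteq> e'" for e e'
  proof -
    have "path_image (drawing G e) \<inter> path_image (drawing G e') \<subseteq> path_image (drawing G e) \<inter> verts G"
      using drawing_Int[of e e'] e[OF that(1)] e[OF that(2)] that(3) by simp
    also have "\<dots> = {fst e, snd e}" using e[OF that(1)] by (intro drawing_arc(4)) simp
    finally show ?thesis using e[OF that(1)] by auto
  qed
  moreover have "edges ?H \<subseteq> black ?H \<times> white ?H" using edge_ends
    by (force simp: induced_subgraph_def)
  moreover have "finite (white ?H)" "finite (black ?H)" "white ?H \<inter> black ?H = {}"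
    using plane by (auto simp: induced_subgraph_def plane_bipartite_graph_def)
  ultimately show ?thesis
    unfolding bipartite_plane_graph_def plane_bipartite_graph_def dr using e drawing_arc(1-3) by simp
qed

text \<open>
  Extension by zero maps closed chains of a subgraph to closed chains of the whole graph.
\<close>

lemma H1_induced:
  assumes "bipartite_plane_graph G" "c \<in> H1 (induced_subgraph G U)" shows "c \<in> H1 G"
proof -
  interpret bipartite_plane_graph G by fact
  let ?H = "induced_subgraph G U"
  have sub: "edges ?H \<subseteq> edges G" by (auto simp: induced_subgraph_def)
  have off: "c e = 0" if "e \<notin> edges ?H" for e using assms(2) that unfolding H1_def by blast
  have b: "boundary G c v = boundary ?H c v" for v
    unfolding boundary_def using finite_edges sub off by (intro sum.mono_neutral_right) auto
  have "boundary ?H c v = 0" if "v \<in> verts G" for v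
  proof (cases "v \<in> verts ?H")
    case True then show ?thesis using assms(2) by (simp add: H1_def)
  next
    case False
    then have "fst e \<noteq> v \<and> snd e \<noteq> v" if "e \<in> edges ?H" for e
      using that edge_ends[of e] by (auto simp: induced_subgraph_def verts_def)
    then show ?thesis unfolding boundary_def by (intro sum.neutral) auto
  qed
  then show ?thesis using off sub by (auto simp: H1_def b)
qed

section \<open>Matchings and the Cauchy-Binet expansion\<close>

locale kasteleyn_matrix = bipartite_plane_graph G for G +
  fixes ws bs :: "complex list" and A :: "complex Matrix.mat"
  assumes ws: "numbering (white G) ws" and bs: "numbering (black G) bs"
    and A: "generalized_kasteleyn_matrix G ws bs A"
begin

lemma entry:
  assumes "i < length ws" "j < length bs"
  shows "(bs ! j, ws ! i) \<in> edges G \<Longrightarrow> cmod (A $$ (i, j)) = 1"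
    "(bs ! j, ws ! i) \<notin> edges G \<Longrightarrow> A $$ (i, j) = 0"
  using A assms unfolding generalized_kasteleyn_matrix_def by meson+

abbreviation "\<alpha> \<equiv> kasteleyn_cochain G ws bs A"

lemma nth_inject: "i < length ws \<Longrightarrow> i' < length ws \<Longrightarrow> ws ! i = ws ! i' \<longleftrightarrow> i = i'"
  "j < length bs \<Longrightarrow> j' < length bs \<Longrightarrow> bs ! j = bs ! j' \<longleftrightarrow> j = j'"
  using ws bs by (auto simp: numbering_def nth_eq_iff_index_eq)

lemma edge_index:
  assumes "e \<in> edges G"
  obtains i j where "i < length ws" "j < length bs" "e = (bs ! j, ws ! i)"
proof -
  have "snd e \<in> set ws" "fst e \<in> set bs" using edge_ends[OF assms] ws bs by (simp_all add: numbering_def)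
  then show ?thesis using that by (metis in_set_conv_nth prod.collapse)
qed

text \<open>
  The defining property of the cochain, which exists uniquely as \<open>\<eta>\<close> is a bijection from
  \<open>\<real>/\<int>\<close> onto the unit circle.
\<close>

lemma kasteleyn_cochain:
  assumes "i < length ws" "j < length bs" "(bs ! j, ws ! i) \<in> edges G"
  shows "\<eta> (\<alpha> (bs ! j, ws ! i)) = A $$ (i, j)"
proof -
  let ?P = "\<lambda>\<alpha>::complex \<times> complex \<Rightarrow> circle. (\<forall>e. e \<notin> edges G \<longrightarrow> \<alpha> e = 0) \<and>
    (\<forall>i<length ws. \<forall>j<length bs. (bs ! j, ws ! i) \<in> edges G \<longrightarrow> A $$ (i, j) = \<eta> (\<alpha> (bs ! j, ws ! i)))"
  have "\<exists>!\<alpha>. ?P \<alpha>"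
  proof (rule ex_ex1I)
    have "\<forall>e. \<exists>x. (e \<notin> edges G \<longrightarrow> x = 0) \<and> (\<forall>i<length ws. \<forall>j<length bs. e \<in> edges G \<longrightarrow>
      e = (bs ! j, ws ! i) \<longrightarrow> A $$ (i, j) = \<eta> x)"
    proof
      fix e
      show "\<exists>x. (e \<notin> edges G \<longrightarrow> x = 0) \<and> (\<forall>i<length ws. \<forall>j<length bs. e \<in> edges G \<longrightarrow>
        e = (bs ! j, ws ! i) \<longrightarrow> A $$ (i, j) = \<eta> x)"
      proof (cases "e \<in> edges G")
        case True
        then obtain i j where ij: "i < length ws" "j < length bs" "e = (bs ! j, ws ! i)" by (rule edge_index)
        then obtain x where "\<eta> x = A $$ (i, j)" using \<eta>_surj entry(1) True by blast
        then show ?thesis using ij True nth_inject by (intro exI[of _ x]) auto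
      qed auto
    qed
    then obtain \<alpha> where "\<forall>e. (e \<notin> edges G \<longrightarrow> \<alpha> e = 0) \<and> (\<forall>i<length ws. \<forall>j<length bs. e \<in> edges G \<longrightarrow>
      e = (bs ! j, ws ! i) \<longrightarrow> A $$ (i, j) = \<eta> (\<alpha> e))" by metis
    then show "\<exists>\<alpha>. ?P \<alpha>" by (intro exI[of _ \<alpha>]) blast
  next
    fix \<alpha> \<beta> assume \<alpha>: "?P \<alpha>" and \<beta>: "?P \<beta>"
    show "\<alpha> = \<beta>"
    proof
      fix e
      show "\<alpha> e = \<beta> e"
      proof (cases "e \<in> edges G")
        case True
        then obtain i j where ij: "i < length ws" "j < length bs" "e = (bs ! j, ws ! i)" by (rule edge_index)
        then have "\<eta> (\<alpha> e) = \<eta> (\<beta> e)" using \<alpha> \<beta> True by metis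
        then show ?thesis by (simp add: \<eta>_inject)
      next
        case False
        then have "\<alpha> e = 0" "\<beta> e = 0" using \<alpha> \<beta> by blast+
        then show ?thesis by simp
      qed
    qed
  qed
  from theI'[OF this] have "?P \<alpha>" unfolding kasteleyn_cochain_def .
  then show ?thesis using assms by metis
qed

definition subgraph_on :: "nat set \<Rightarrow> nat set \<Rightarrow> plane_graph" where
  "subgraph_on I J = induced_subgraph G ((!) ws ` I \<union> (!) bs ` J)"

definition bijections :: "nat set \<Rightarrow> nat set \<Rightarrow> (nat \<Rightarrow> nat) set" where
  "bijections I J = {f \<in> I \<rightarrow>\<^sub>E {0..<length bs}. inj_on f I \<and> f ` I = J}"

definition edge_bijections :: "nat set \<Rightarrow> nat set \<Rightarrow> (nat \<Rightarrow> nat) set" where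
  "edge_bijections I J = {f \<in> bijections I J. \<forall>i\<in>I. (bs ! f i, ws ! i) \<in> edges G}"

definition matching_of :: "nat set \<Rightarrow> (nat \<Rightarrow> nat) \<Rightarrow> (complex \<times> complex) set" where
  "matching_of I f = (\<lambda>i. (bs ! f i, ws ! i)) ` I"

context
  fixes I J assumes I: "I \<subseteq> {0..<length ws}" and J: "J \<subseteq> {0..<length bs}"
begin

lemma ltI: "i \<in> I \<Longrightarrow> i < length ws" and ltJ: "j \<in> J \<Longrightarrow> j < length bs"
  using I J by auto

lemma white_vertex: "i < length ws \<Longrightarrow> ws ! i \<in> white G" and black_vertex: "j < length bs \<Longrightarrow> bs ! j \<in> black G"
  using ws bs by (auto simp: numbering_def)

lemma subgraph_on_simps:
  "white (subgraph_on I J) = (!) ws ` I" "black (subgraph_on I J) = (!) bs ` J"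
  "verts (subgraph_on I J) = (!) ws ` I \<union> (!) bs ` J"
  "edges (subgraph_on I J) = {e \<in> edges G. fst e \<in> (!) bs ` J \<and> snd e \<in> (!) ws ` I}"
proof -
  have w: "(!) ws ` I \<subseteq> white G" "(!) bs ` J \<subseteq> black G" using ltI ltJ white_vertex black_vertex by auto
  then show 1: "white (subgraph_on I J) = (!) ws ` I" "black (subgraph_on I J) = (!) bs ` J"
    using colours_disjoint unfolding subgraph_on_def induced_subgraph_def by (simp_all, blast+)
  show "verts (subgraph_on I J) = (!) ws ` I \<union> (!) bs ` J" by (simp add: verts_def 1)
  show "edges (subgraph_on I J) = {e \<in> edges G. fst e \<in> (!) bs ` J \<and> snd e \<in> (!) ws ` I}"
  proof -
    let ?U = "(!) ws ` I \<union> (!) bs ` J"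
    have "fst e \<in> ?U \<longleftrightarrow> fst e \<in> (!) bs ` J" "snd e \<in> ?U \<longleftrightarrow> snd e \<in> (!) ws ` I" if "e \<in> edges G" for e
      using w edge_ends[OF that] colours_disjoint by blast+
    moreover have "edges (subgraph_on I J) = {e \<in> edges G. fst e \<in> ?U \<and> snd e \<in> ?U}"
      by (auto simp: subgraph_on_def induced_subgraph_def)
    ultimately show ?thesis by (simp only: cong: conj_cong)
  qed
qed

lemma inj_ws: "inj_on ((!) ws) I" and inj_bs: "inj_on ((!) bs) J"
  using nth_inject ltI ltJ by (auto simp: inj_on_def)

lemma inj_edge: "inj_on (\<lambda>i. (bs ! f i, ws ! i)) I"
  using nth_inject(1) ltI by (auto simp: inj_on_def)

lemma inj_matching_of: "inj_on (matching_of I) (bijections I J)"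
proof (rule inj_onI)
  fix f g assume f: "f \<in> bijections I J" and g: "g \<in> bijections I J" and eq: "matching_of I f = matching_of I g"
  show "f = g"
  proof (rule PiE_ext[of f I "\<lambda>_. {0..<length bs}" g])
    fix i assume i: "i \<in> I"
    then have "(bs ! f i, ws ! i) \<in> matching_of I g" using eq by (auto simp: matching_of_def)
    then obtain i' where "i' \<in> I" "bs ! f i = bs ! g i'" "ws ! i = ws ! i'" by (auto simp: matching_of_def)
    moreover have "f i < length bs" "g i < length bs" using f g i by (auto simp: bijections_def)
    ultimately show "f i = g i" using nth_inject ltI i by metis
  qed (use f g in \<open>auto simp: bijections_def\<close>)
qed

text \<open>
  A matching assigns to every white vertex a black neighbour, and it covers every black vertex exactly once.
\<close>

lemma matchings_subgraph_on: "matchings (subgraph_on I J) = matching_of I ` edge_bijections I J"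
proof (intro equalityI subsetI)
  fix M assume "M \<in> matching_of I ` edge_bijections I J"
  then obtain f where f: "f \<in> edge_bijections I J" and M: "M = matching_of I f" by auto
  have fJ: "f i \<in> J" if "i \<in> I" for i using f that by (auto simp: edge_bijections_def bijections_def)
  have sub: "M \<subseteq> edges (subgraph_on I J)"
    unfolding M matching_of_def subgraph_on_simps using f fJ by (auto simp: edge_bijections_def)
  have col: "ws ! i \<noteq> bs ! j" if "i \<in> I" "j \<in> J" for i j
    using colours_disjoint white_vertex[OF ltI] black_vertex[OF ltJ] that by metis
  have "\<exists>!e. e \<in> M \<and> (fst e = v \<or> snd e = v)" if v: "v \<in> verts (subgraph_on I J)" for v
  proof -
    from v consider i where "i \<in> I" "v = ws ! i" | i where "i \<in> I" "v = bs ! f i"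
      using f unfolding subgraph_on_simps edge_bijections_def bijections_def by blast
    then obtain i where i: "i \<in> I" "v = ws ! i \<or> v = bs ! f i" by metis
    show ?thesis
    proof (rule ex1I[of _ "(bs ! f i, ws ! i)"])
      show "(bs ! f i, ws ! i) \<in> M \<and> (fst (bs ! f i, ws ! i) = v \<or> snd (bs ! f i, ws ! i) = v)"
        using i by (auto simp: M matching_of_def)
      fix e assume "e \<in> M \<and> (fst e = v \<or> snd e = v)"
      then obtain i' where i': "i' \<in> I" "e = (bs ! f i', ws ! i')" "bs ! f i' = v \<or> ws ! i' = v"
        by (auto simp: M matching_of_def)
      have "bs ! f i' = bs ! f i \<or> ws ! i' = ws ! i"
        using i i' col[OF i(1) fJ[OF i'(1)]] col[OF i'(1) fJ[OF i(1)]] by auto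
      then have "f i' = f i \<or> i' = i" using nth_inject ltI ltJ fJ i i' by metis
      moreover have "inj_on f I" using f by (auto simp: edge_bijections_def bijections_def)
      ultimately show "e = (bs ! f i, ws ! i)" using i i' by (auto dest: inj_onD)
    qed
  qed
  then show "M \<in> matchings (subgraph_on I J)" using sub by (simp add: matchings_def)
next
  fix M assume M: "M \<in> matchings (subgraph_on I J)"
  have MG: "\<exists>i\<in>I. \<exists>j\<in>J. e = (bs ! j, ws ! i) \<and> e \<in> edges G" if "e \<in> M" for e
  proof -
    have "e \<in> edges (subgraph_on I J)" using M that by (auto simp: matchings_def)
    then show ?thesis unfolding subgraph_on_simps by (cases e) auto
  qed
  have ex1_M: "\<exists>!e. e \<in> M \<and> (fst e = v \<or> snd e = v)" if "v \<in> verts (subgraph_on I J)" for v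
    using M that by (simp add: matchings_def)
  have uniq: "e = e'" if e: "e \<in> M" "e' \<in> M" "fst e = fst e' \<or> snd e = snd e'" for e e'
  proof -
    obtain i j where "i \<in> I" "j \<in> J" "e = (bs ! j, ws ! i)" using MG[OF e(1)] by blast
    then have "fst e \<in> verts (subgraph_on I J)" "snd e \<in> verts (subgraph_on I J)" unfolding subgraph_on_simps by auto
    note ex1 = ex1_M[OF this(1)] ex1_M[OF this(2)]
    show ?thesis
    proof (cases "fst e = fst e'")
      case True then show ?thesis using ex1(1) e(1,2) by metis
    next
      case False then show ?thesis using ex1(2) e by metis
    qed
  qed
  have col: "ws ! i \<noteq> bs ! j" if "i \<in> I" "j \<in> J" for i j
    using colours_disjoint white_vertex[OF ltI] black_vertex[OF ltJ] that by metis
  have "\<exists>j\<in>J. (bs ! j, ws ! i) \<in> M" if i: "i \<in> I" for i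
  proof -
    have "ws ! i \<in> verts (subgraph_on I J)" using i unfolding subgraph_on_simps by auto
    then obtain e where e: "e \<in> M" "fst e = ws ! i \<or> snd e = ws ! i" using ex1_M by blast
    obtain i' j where ij: "i' \<in> I" "j \<in> J" "e = (bs ! j, ws ! i')" using MG[OF e(1)] by blast
    then have "ws ! i' = ws ! i" using e(2) col[OF i ij(2)] by simp
    then show ?thesis using e(1) ij by metis
  qed
  then obtain f0 where f0: "\<And>i. i \<in> I \<Longrightarrow> f0 i \<in> J \<and> (bs ! f0 i, ws ! i) \<in> M" by metis
  define f where "f = restrict f0 I"
  have f: "f i \<in> J" "(bs ! f i, ws ! i) \<in> M" if "i \<in> I" for i using f0[OF that] that by (simp_all add: f_def)
  have "inj_on f I"
  proof (rule inj_onI)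
    fix i i' assume i: "i \<in> I" "i' \<in> I" "f i = f i'"
    have "(bs ! f i, ws ! i) = (bs ! f i', ws ! i')"
      using uniq[OF f(2)[OF i(1)] f(2)[OF i(2)]] i(3) by simp
    then show "i = i'" using nth_inject(1) ltI i(1,2) by auto
  qed
  moreover have "f ` I = J"
  proof (intro equalityI subsetI)
    fix j assume j: "j \<in> J"
    then have "bs ! j \<in> verts (subgraph_on I J)" unfolding subgraph_on_simps by auto
    then obtain e where e: "e \<in> M" "fst e = bs ! j \<or> snd e = bs ! j" using ex1_M by blast
    obtain i j' where ij: "i \<in> I" "j' \<in> J" "e = (bs ! j', ws ! i)" using MG[OF e(1)] by blast
    then have "bs ! j' = bs ! j" using e(2) col[OF ij(1) j] by auto
    moreover have "e = (bs ! f i, ws ! i)" using uniq[OF e(1) f(2)[OF ij(1)]] ij(3) by simp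
    ultimately have "bs ! f i = bs ! j" using ij by simp
    then show "j \<in> f ` I" using nth_inject(2) ltJ j f(1)[OF ij(1)] ij(1) by blast
  qed (use f in auto)
  moreover have "f \<in> I \<rightarrow>\<^sub>E {0..<length bs}" using f ltJ by (auto simp: f_def)
  ultimately have "f \<in> edge_bijections I J"
    using f MG unfolding edge_bijections_def bijections_def by blast
  moreover have "M = matching_of I f"
  proof (intro equalityI subsetI)
    fix e assume e: "e \<in> M"
    obtain i j where ij: "i \<in> I" "j \<in> J" "e = (bs ! j, ws ! i)" using MG[OF e] by blast
    then have "e = (bs ! f i, ws ! i)" using uniq[OF e f(2)[OF ij(1)]] by simp
    then show "e \<in> matching_of I f" using ij by (auto simp: matching_of_def)
  qed (use f in \<open>auto simp: matching_of_def\<close>)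
  ultimately show "M \<in> matching_of I ` edge_bijections I J" by blast
qed

end
end

lemma sum_indicator_image:
  assumes "finite I" "inj_on h I"
  shows "(\<Sum>i\<in>I. if e = h i then 1 else 0 :: int) = matching_chain (h ` I) e"
proof (cases "e \<in> h ` I")
  case True
  then obtain i0 where "i0 \<in> I" "e = h i0" by auto
  then have "(\<Sum>i\<in>I. if e = h i then 1 else 0 :: int) = (\<Sum>i\<in>I. if i = i0 then 1 else 0)"
    using assms(2) by (intro sum.cong) (auto dest: inj_onD)
  then show ?thesis using True assms(1) \<open>i0 \<in> I\<close> by (simp add: matching_chain_def)
next
  case False
  then show ?thesis by (auto simp: matching_chain_def intro!: sum.neutral)
qed

context kasteleyn_matrix
begin

lemma \<eta>_pairing_matching:
  assumes I: "I \<subseteq> {0..<length ws}" and f: "\<And>i. i \<in> I \<Longrightarrow> f i < length bs \<and> (bs ! f i, ws ! i) \<in> edges G"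
  shows "\<eta> (\<Sum>e\<in>edges G. int_scale (matching_chain (matching_of I f) e) (\<alpha> e)) = (\<Prod>i\<in>I. A $$ (i, f i))"
proof -
  have sub: "matching_of I f \<subseteq> edges G" using f by (auto simp: matching_of_def)
  have inj: "inj_on (\<lambda>i. (bs ! f i, ws ! i)) I" by (rule inj_edge[OF I empty_subsetI])
  have "(\<Sum>e\<in>edges G. int_scale (matching_chain (matching_of I f) e) (\<alpha> e)) =
    (\<Sum>e\<in>edges G. if e \<in> matching_of I f then \<alpha> e else 0)"
    by (intro sum.cong) (simp_all add: matching_chain_def int_scale_simps)
  also have "\<dots> = (\<Sum>e\<in>edges G \<inter> matching_of I f. \<alpha> e)" by (rule sum.inter_restrict[OF finite_edges, symmetric])
  also have "edges G \<inter> matching_of I f = matching_of I f" using sub by blast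
  also have "(\<Sum>e\<in>matching_of I f. \<alpha> e) = (\<Sum>i\<in>I. \<alpha> (bs ! f i, ws ! i))"
    unfolding matching_of_def by (subst sum.reindex[OF inj]) simp
  finally show ?thesis using f I by (simp add: \<eta>_sum) (intro prod.cong; auto intro!: kasteleyn_cochain)
qed

text \<open>
  The class \<open>a + k\<^sub>H\<close> of the subgraph \<open>H\<close> on \<open>I\<close> and \<open>J\<close>.
\<close>

definition total_class :: "nat set \<Rightarrow> nat set \<Rightarrow> chain \<Rightarrow> circle" where
  "total_class I J c = restrict_class (subgraph_on I J) (matrix_class G ws bs A) c + half (kasteleyn_class (subgraph_on I J) c)"

text \<open>
  A summand of \<open>\<delta>\<close> is a summand of the Cauchy-Binet expansion: \<open>a\<close> contributes the two products and
  \<open>k\<^sub>H\<close> the sign.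
\<close>

lemma matching_term:
  assumes I: "I \<subseteq> {0..<length ws}" and J: "J \<subseteq> {0..<length bs}"
    and f: "f \<in> edge_bijections I J" and \<sigma>: "\<sigma> permutes I" and g: "restrict (f \<circ> \<sigma>) I \<in> edge_bijections I J"
  shows "\<eta> (total_class I J (\<lambda>e. matching_chain (matching_of I f) e - matching_chain (matching_of I (restrict (f \<circ> \<sigma>) I)) e))
    = of_int (sign \<sigma>) * ((\<Prod>i\<in>I. A $$ (i, f i)) * (\<Prod>i\<in>I. cnj (A $$ (i, f (\<sigma> i)))))"
proof -
  let ?H = "subgraph_on I J" and ?g = "restrict (f \<circ> \<sigma>) I"
  note simps = subgraph_on_simps[OF I J]
  have finI: "finite I" using I finite_subset by blast
  have fJ: "f i \<in> J" "f i < length bs" "(bs ! f i, ws ! i) \<in> edges G" if "i \<in> I" for i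
    using f that J by (auto simp: edge_bijections_def bijections_def)
  have gJ: "?g i \<in> J" "?g i < length bs" "(bs ! ?g i, ws ! i) \<in> edges G" if "i \<in> I" for i
    using g that J by (auto simp: edge_bijections_def bijections_def)
  have fI: "f ` I = J" "inj_on f I" using f by (auto simp: edge_bijections_def bijections_def)
  have "bipartite_plane_graph ?H" unfolding subgraph_on_def by (rule bipartite_plane_graph_induced) unfold_locales
  moreover have "inj_on (\<lambda>i. bs ! f i) I"
    using comp_inj_on[OF fI(2), of "(!) bs"] inj_bs[OF I J] fI(1) by (simp add: o_def)
  moreover have "(\<lambda>i. bs ! f i) ` I = black ?H" unfolding simps using fI(1) by auto
  moreover have "(bs ! f i, ws ! i) \<in> edges ?H" if "i \<in> I" for i
    unfolding simps using fJ[OF that] that by auto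
  ultimately interpret M: matched_plane_graph ?H I "(!) ws" "\<lambda>i. bs ! f i"
    using finI inj_ws[OF I J] unfolding matched_plane_graph_def matched_plane_graph_axioms_def
    by (simp add: simps(1))
  have eg: "(bs ! f (\<sigma> i), ws ! i) \<in> edges ?H" if "i \<in> I" for i
    unfolding simps using gJ[OF that] that by auto
  let ?D = "M.permuted_difference \<sigma>"
  define c where "c = (\<lambda>e. matching_chain (matching_of I f) e - matching_chain (matching_of I ?g) e)"
  have mg: "matching_of I ?g = (\<lambda>i. (bs ! f (\<sigma> i), ws ! i)) ` I"
    unfolding matching_of_def by (intro image_cong) auto
  have D: "?D e = matching_chain (matching_of I ?g) e - matching_chain (matching_of I f) e" for e
    unfolding M.permuted_difference_def sum_subtractf mg unfolding matching_of_def
    using sum_indicator_image[OF finI inj_edge[OF I J, of "\<lambda>i. f (\<sigma> i)"]]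
      sum_indicator_image[OF finI inj_edge[OF I J, of f]] by simp
  have DH: "?D \<in> H1 ?H" by (rule M.permuted_difference_in_H1[OF \<sigma> eg])
  have "c = (\<lambda>e. 0 - ?D e)" unfolding c_def D by auto
  then have cH: "c \<in> H1 ?H" using M.H1_diff[OF M.zero_in_H1 DH] by simp
  \<comment> \<open>\<open>c = - ?D\<close>, but signs do not matter in \<open>\<int>/(2)\<close>.\<close>
  have "M.k (\<lambda>e. c e + ?D e) = M.k c + M.k ?D" by (rule M.class_add[OF cH DH])
  moreover have "(\<lambda>e. c e + ?D e) = (\<lambda>e. 0)" unfolding c_def D by simp
  ultimately have "M.k c + M.k ?D = 0" using M.class_zero by simp
  then have "M.k c = M.k ?D" by (cases "M.k c"; cases "M.k ?D") simp_all
  then have k: "M.k c = of_bool (sign \<sigma> = -1)"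
    using M.kasteleyn_class_of_permutation[OF \<sigma> eg] by simp
  then have \<eta>k: "\<eta> (half (M.k c)) = of_int (sign \<sigma>)"
    by (cases \<sigma> rule: sign_cases) (simp_all add: \<eta>_half)
  have "bipartite_plane_graph G" by unfold_locales
  then have cG: "c \<in> H1 G" using cH unfolding subgraph_on_def by (rule H1_induced)
  have "restrict_class ?H (matrix_class G ws bs A) c = (\<Sum>e\<in>edges G. int_scale (c e) (\<alpha> e))"
    using cH cG by (simp add: restrict_class_def matrix_class_def cochain_class_def)
  also have "\<dots> = (\<Sum>e\<in>edges G. int_scale (matching_chain (matching_of I f) e) (\<alpha> e)) -
    (\<Sum>e\<in>edges G. int_scale (matching_chain (matching_of I ?g) e) (\<alpha> e))"
    by (simp add: c_def int_scale_simps sum_subtractf)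
  finally have "\<eta> (restrict_class ?H (matrix_class G ws bs A) c) =
      (\<Prod>i\<in>I. A $$ (i, f i)) * cnj (\<Prod>i\<in>I. A $$ (i, ?g i))"
    using \<eta>_pairing_matching[OF I, of f] \<eta>_pairing_matching[OF I, of ?g] fJ gJ by (simp add: \<eta>_diff)
  also have "cnj (\<Prod>i\<in>I. A $$ (i, ?g i)) = (\<Prod>i\<in>I. cnj (A $$ (i, f (\<sigma> i))))"
    unfolding cnj_prod by (intro prod.cong) auto
  finally show ?thesis unfolding c_def[symmetric] total_class_def \<eta>_add \<eta>k by (simp add: mult.commute)
qed

text \<open>
  A pair of bijections from \<open>I\<close> to \<open>J\<close> is the same as one bijection and a permutation of \<open>I\<close>.
\<close>

lemma bij_permutations_bijections:
  assumes f: "f \<in> bijections I J"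
  shows "bij_betw (\<lambda>\<sigma>. restrict (f \<circ> \<sigma>) I) {\<sigma>. \<sigma> permutes I} (bijections I J)"
proof -
  have fI: "inj_on f I" "f ` I = J" "f \<in> I \<rightarrow>\<^sub>E {0..<length bs}" using f by (auto simp: bijections_def)
  show ?thesis
  proof (rule bij_betwI')
    fix \<sigma> \<tau> assume "\<sigma> \<in> {\<sigma>. \<sigma> permutes I}" "\<tau> \<in> {\<sigma>. \<sigma> permutes I}"
    then have p: "\<sigma> permutes I" "\<tau> permutes I" by auto
    show "restrict (f \<circ> \<sigma>) I = restrict (f \<circ> \<tau>) I \<longleftrightarrow> \<sigma> = \<tau>"
    proof
      assume eq: "restrict (f \<circ> \<sigma>) I = restrict (f \<circ> \<tau>) I"
      show "\<sigma> = \<tau>"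
      proof
        fix i show "\<sigma> i = \<tau> i"
        proof (cases "i \<in> I")
          case True
          then have "f (\<sigma> i) = f (\<tau> i)" using fun_cong[OF eq, of i] by simp
          then show ?thesis using fI(1) True permutes_in_image[OF p(1)] permutes_in_image[OF p(2)]
            by (auto dest: inj_onD)
        next
          case False then show ?thesis using p by (simp add: permutes_def)
        qed
      qed
    qed simp
  next
    fix \<sigma> assume "\<sigma> \<in> {\<sigma>. \<sigma> permutes I}"
    then have p: "\<sigma> permutes I" by simp
    have im: "\<sigma> ` I = I" by (rule permutes_image[OF p])
    have "inj_on (f \<circ> \<sigma>) I" using p fI(1) im by (intro comp_inj_on) (auto intro: permutes_inj_on)
    then have "inj_on (restrict (f \<circ> \<sigma>) I) I" by (simp add: inj_on_restrict_eq)
    moreover have "restrict (f \<circ> \<sigma>) I ` I = J"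
    proof -
      have "restrict (f \<circ> \<sigma>) I ` I = (f \<circ> \<sigma>) ` I" by (intro image_cong) auto
      then show ?thesis by (simp only: image_comp[symmetric] im fI(2))
    qed
    moreover have "restrict (f \<circ> \<sigma>) I \<in> I \<rightarrow>\<^sub>E {0..<length bs}"
      using fI(3) permutes_in_image[OF p] by auto
    ultimately show "restrict (f \<circ> \<sigma>) I \<in> bijections I J" by (simp add: bijections_def)
  next
    fix g assume "g \<in> bijections I J"
    then have gI: "inj_on g I" "g ` I = J" "g \<in> I \<rightarrow>\<^sub>E {0..<length bs}" by (auto simp: bijections_def)
    define \<sigma> where "\<sigma> i = (if i \<in> I then inv_into I f (g i) else i)" for i
    have "bij_betw (inv_into I f \<circ> g) I I"
      using gI fI bij_betw_inv_into[of f I J] by (intro bij_betw_trans[of g I J]) (auto simp: bij_betw_def)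
    then have "bij_betw \<sigma> I I" by (rule bij_betw_cong[THEN iffD1, rotated]) (simp add: \<sigma>_def)
    then have "\<sigma> permutes I" by (rule bij_imp_permutes) (simp add: \<sigma>_def)
    moreover have "g = restrict (f \<circ> \<sigma>) I"
    proof (rule PiE_ext[OF gI(3), of "restrict (f \<circ> \<sigma>) I"])
      show "restrict (f \<circ> \<sigma>) I \<in> I \<rightarrow>\<^sub>E {0..<length bs}"
        using fI(3) permutes_in_image[OF \<open>\<sigma> permutes I\<close>] by auto
      fix i assume "i \<in> I"
      then show "g i = restrict (f \<circ> \<sigma>) I i" using gI(2) fI(2) by (auto simp: \<sigma>_def intro: f_inv_into_f[symmetric])
    qed
    ultimately show "\<exists>\<sigma>\<in>{\<sigma>. \<sigma> permutes I}. g = restrict (f \<circ> \<sigma>) I" by blast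
  qed
qed

text \<open>
  Bijections that are not along edges can be included in both sums, because the corresponding product
  of matrix entries vanishes.
\<close>

lemma \<delta>_subgraph_on:
  assumes I: "I \<subseteq> {0..<length ws}" and J: "J \<subseteq> {0..<length bs}"
  shows "\<delta> (total_class I J) (subgraph_on I J) = (\<Sum>f\<in>bijections I J. \<Sum>\<sigma> | \<sigma> permutes I.
    of_int (sign \<sigma>) * ((\<Prod>i\<in>I. A $$ (i, f i)) * (\<Prod>i\<in>I. cnj (A $$ (i, f (\<sigma> i))))))"
proof -
  let ?F = "bijections I J" and ?E = "edge_bijections I J"
  have finI: "finite I" using I finite_subset by blast
  have finF: "finite ?F" unfolding bijections_def
    by (rule finite_subset[of _ "I \<rightarrow>\<^sub>E {0..<length bs}"]) (auto simp: finI intro: finite_PiE)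
  let ?h = "\<lambda>f g. \<eta> (total_class I J (\<lambda>e. matching_chain (matching_of I f) e - matching_chain (matching_of I g) e))"
  let ?T = "\<lambda>f \<sigma>. of_int (sign \<sigma>) * ((\<Prod>i\<in>I. A $$ (i, f i)) * (\<Prod>i\<in>I. cnj (A $$ (i, f (\<sigma> i)))))"
  have EF: "?E \<subseteq> ?F" by (auto simp: edge_bijections_def)
  have inj: "inj_on (matching_of I) ?E" using inj_matching_of[OF I J] EF by (rule inj_on_subset)
  have zero: "(\<Prod>i\<in>I. A $$ (i, f i)) = 0" if f: "f \<in> ?F" "f \<notin> ?E" for f
  proof -
    obtain i where i: "i \<in> I" "(bs ! f i, ws ! i) \<notin> edges G" using f by (auto simp: edge_bijections_def)
    moreover have "i < length ws" "f i < length bs" using i(1) I f(1) by (auto simp: bijections_def)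
    ultimately have "A $$ (i, f i) = 0" by (intro entry(2))
    then show ?thesis using i(1) finI by auto
  qed
  have "\<delta> (total_class I J) (subgraph_on I J) = (\<Sum>f\<in>?E. \<Sum>g\<in>?E. ?h f g)"
    unfolding \<delta>_def matchings_subgraph_on[OF I J] by (simp add: sum.reindex[OF inj])
  also have "\<dots> = (\<Sum>f\<in>?F. \<Sum>g\<in>?F. if f \<in> ?E \<and> g \<in> ?E then ?h f g else 0)"
  proof -
    have restr: "(\<Sum>f\<in>?E. u f) = (\<Sum>f\<in>?F. if f \<in> ?E then u f else 0)" for u :: "(nat \<Rightarrow> nat) \<Rightarrow> complex"
    proof -
      have "?F \<inter> ?E = ?E" using EF by blast
      then show ?thesis using sum.inter_restrict[OF finF, of u ?E] by (simp only:)
    qed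
    have "(\<Sum>f\<in>?E. \<Sum>g\<in>?E. ?h f g) = (\<Sum>f\<in>?F. if f \<in> ?E then (\<Sum>g\<in>?F. if g \<in> ?E then ?h f g else 0) else 0)"
      by (simp only: restr)
    also have "\<dots> = (\<Sum>f\<in>?F. \<Sum>g\<in>?F. if f \<in> ?E \<and> g \<in> ?E then ?h f g else 0)"
    proof (rule sum.cong[OF refl])
      fix f show "(if f \<in> ?E then \<Sum>g\<in>?F. if g \<in> ?E then ?h f g else 0 else 0) =
        (\<Sum>g\<in>?F. if f \<in> ?E \<and> g \<in> ?E then ?h f g else 0)"
        by (cases "f \<in> ?E") simp_all
    qed
    finally show ?thesis .
  qed
  also have "\<dots> = (\<Sum>f\<in>?F. \<Sum>\<sigma> | \<sigma> permutes I. ?T f \<sigma>)"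
  proof (rule sum.cong[OF refl])
    fix f assume f: "f \<in> ?F"
    have "(\<Sum>g\<in>?F. if f \<in> ?E \<and> g \<in> ?E then ?h f g else 0) =
      (\<Sum>\<sigma> | \<sigma> permutes I. if f \<in> ?E \<and> restrict (f \<circ> \<sigma>) I \<in> ?E then ?h f (restrict (f \<circ> \<sigma>) I) else 0)"
      by (rule sum.reindex_bij_betw[OF bij_permutations_bijections[OF f], symmetric])
    also have "\<dots> = (\<Sum>\<sigma> | \<sigma> permutes I. ?T f \<sigma>)"
    proof (rule sum.cong[OF refl])
      fix \<sigma> assume "\<sigma> \<in> {\<sigma>. \<sigma> permutes I}"
      then have \<sigma>: "\<sigma> permutes I" by simp
      let ?g = "restrict (f \<circ> \<sigma>) I"
      have g: "?g \<in> ?F" using bij_permutations_bijections[OF f] \<sigma> by (auto simp: bij_betw_def)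
      have gp: "(\<Prod>i\<in>I. cnj (A $$ (i, f (\<sigma> i)))) = cnj (\<Prod>i\<in>I. A $$ (i, ?g i))"
        unfolding cnj_prod by (intro prod.cong) auto
      show "(if f \<in> ?E \<and> ?g \<in> ?E then ?h f ?g else 0) = ?T f \<sigma>"
      proof (cases "f \<in> ?E \<and> ?g \<in> ?E")
        case True then show ?thesis using matching_term[OF I J _ \<sigma>] by simp
      next
        case False
        then have "(\<Prod>i\<in>I. A $$ (i, f i)) = 0 \<or> (\<Prod>i\<in>I. A $$ (i, ?g i)) = 0" using zero f g by blast
        then show ?thesis unfolding gp if_not_P[OF False] by (elim disjE) simp_all
      qed
    qed
    finally show "(\<Sum>g\<in>?F. if f \<in> ?E \<and> g \<in> ?E then ?h f g else 0) = (\<Sum>\<sigma> | \<sigma> permutes I. ?T f \<sigma>)" .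
  qed
  finally show ?thesis .
qed

lemma bij_balanced_subgraphs:
  "bij_betw (\<lambda>(I, J). subgraph_on I J)
    (SIGMA I:{I. I \<subseteq> {0..<length ws} \<and> card I = m}. {J. J \<subseteq> {0..<length bs} \<and> card J = m})
    {H \<in> induced_subgraphs G. balanced H \<and> card (verts H) = 2 * m}"
proof -
  let ?S = "SIGMA I:{I. I \<subseteq> {0..<length ws} \<and> card I = m}. {J. J \<subseteq> {0..<length bs} \<and> card J = m}"
  have injw: "inj_on ((!) ws) {0..<length ws}" and injb: "inj_on ((!) bs) {0..<length bs}"
    using inj_ws[of "{0..<length ws}" "{}"] inj_bs[of "{}" "{0..<length bs}"] by auto
  have card: "card (white (subgraph_on I J)) = card I" "card (black (subgraph_on I J)) = card J"
    "card (verts (subgraph_on I J)) = card I + card J"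
    if IJ: "I \<subseteq> {0..<length ws}" "J \<subseteq> {0..<length bs}" for I J
  proof -
    show c: "card (white (subgraph_on I J)) = card I" "card (black (subgraph_on I J)) = card J"
      unfolding subgraph_on_simps[OF IJ] using inj_ws[OF IJ] inj_bs[OF IJ] by (simp_all add: card_image)
    interpret S: bipartite_plane_graph "subgraph_on I J" unfolding subgraph_on_def by (rule bipartite_plane_graph_induced) unfold_locales
    have "white (subgraph_on I J) \<inter> black (subgraph_on I J) = {}" "finite (white (subgraph_on I J))" "finite (black (subgraph_on I J))"
      using S.plane by (auto simp: plane_bipartite_graph_def)
    then show "card (verts (subgraph_on I J)) = card I + card J"
      by (simp add: verts_def card_Un_disjoint c)
  qed
  show ?thesis
  proof (rule bij_betwI')
    fix p q assume "p \<in> ?S" "q \<in> ?S"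
    then obtain I J I' J' where pq: "p = (I, J)" "q = (I', J')"
      and IJ: "I \<subseteq> {0..<length ws}" "J \<subseteq> {0..<length bs}" and IJ': "I' \<subseteq> {0..<length ws}" "J' \<subseteq> {0..<length bs}"
      by auto
    show "(case p of (I, J) \<Rightarrow> subgraph_on I J) = (case q of (I, J) \<Rightarrow> subgraph_on I J) \<longleftrightarrow> p = q"
    proof
      assume "(case p of (I, J) \<Rightarrow> subgraph_on I J) = (case q of (I, J) \<Rightarrow> subgraph_on I J)"
      then have "subgraph_on I J = subgraph_on I' J'" by (simp add: pq)
      then have "(!) ws ` I = (!) ws ` I'" "(!) bs ` J = (!) bs ` J'"
        using subgraph_on_simps(1,2)[OF IJ] subgraph_on_simps(1,2)[OF IJ'] by simp_all
      then show "p = q" unfolding pq using inj_on_image_eq_iff[OF injw IJ(1) IJ'(1)] inj_on_image_eq_iff[OF injb IJ(2) IJ'(2)]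
        by simp
    qed simp
  next
    fix p assume "p \<in> ?S"
    then obtain I J where p: "p = (I, J)" and IJ: "I \<subseteq> {0..<length ws}" "J \<subseteq> {0..<length bs}"
      and m: "card I = m" "card J = m" by auto
    have "verts (subgraph_on I J) \<subseteq> verts G" unfolding subgraph_on_def by (auto simp: induced_subgraph_def verts_def)
    then have "subgraph_on I J \<in> induced_subgraphs G"
      unfolding subgraph_on_simps[OF IJ] induced_subgraphs_def by (intro image_eqI[of _ _ "(!) ws ` I \<union> (!) bs ` J"]) (auto simp: subgraph_on_def)
    then show "(case p of (I, J) \<Rightarrow> subgraph_on I J) \<in> {H \<in> induced_subgraphs G. balanced H \<and> card (verts H) = 2 * m}"
      using card[OF IJ] m by (simp add: p balanced_def)
  next
    fix H assume H: "H \<in> {H \<in> induced_subgraphs G. balanced H \<and> card (verts H) = 2 * m}"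
    then obtain U where U: "U \<subseteq> verts G" "H = induced_subgraph G U" by (auto simp: induced_subgraphs_def)
    define I where "I = {i \<in> {0..<length ws}. ws ! i \<in> U}"
    define J where "J = {j \<in> {0..<length bs}. bs ! j \<in> U}"
    have IJ: "I \<subseteq> {0..<length ws}" "J \<subseteq> {0..<length bs}" by (auto simp: I_def J_def)
    have "U = (!) ws ` I \<union> (!) bs ` J"
    proof
      show "U \<subseteq> (!) ws ` I \<union> (!) bs ` J"
      proof
        fix v assume v: "v \<in> U"
        then have "v \<in> set ws \<or> v \<in> set bs" using U(1) ws bs by (auto simp: verts_def numbering_def)
        then show "v \<in> (!) ws ` I \<union> (!) bs ` J" using v by (auto simp: I_def J_def in_set_conv_nth)
      qed
    qed (auto simp: I_def J_def)
    then have HS: "H = subgraph_on I J" using U(2) by (simp add: subgraph_on_def)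
    have "card I = card J" "card I + card J = 2 * m" using H card[OF IJ] by (auto simp: HS balanced_def)
    then show "\<exists>p\<in>?S. H = (case p of (I, J) \<Rightarrow> subgraph_on I J)"
      using IJ HS by (intro bexI[of _ "(I, J)"]) auto
  qed
qed

text \<open>
  The balanced induced subgraphs with \<open>2 m\<close> vertices correspond to pairs \<open>(I, J)\<close> of \<open>m\<close>-sets of
  white and black indices, and \<open>J\<close> is the image of the bijection in the Cauchy-Binet expansion.
\<close>

theorem singular_polynomial_coeff:
  assumes m: "m \<le> length ws"
  shows "poly.coeff (singular_polynomial A) (length ws - m) = (-1) ^ m *
    (\<Sum>H | H \<in> induced_subgraphs G \<and> balanced H \<and> card (verts H) = 2 * m.
       \<delta> (\<lambda>c. restrict_class H (matrix_class G ws bs A) c + half (kasteleyn_class H c)) H)"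
proof -
  let ?P = "{I. I \<subseteq> {0..<length ws} \<and> card I = m}" and ?Q = "{J. J \<subseteq> {0..<length bs} \<and> card J = m}"
  let ?T = "\<lambda>I f. \<Sum>\<sigma> | \<sigma> permutes I. of_int (sign \<sigma>) * ((\<Prod>i\<in>I. A $$ (i, f i)) * (\<Prod>i\<in>I. cnj (A $$ (i, f (\<sigma> i)))))"
  let ?\<delta> = "\<lambda>H. \<delta> (\<lambda>c. restrict_class H (matrix_class G ws bs A) c + half (kasteleyn_class H c)) H"
  have carrier: "A \<in> carrier_mat (length ws) (length bs)" using A by (simp add: generalized_kasteleyn_matrix_def)
  have fin: "finite ?P" "finite ?Q" by simp_all
  have "(\<Sum>f\<in>{f \<in> I \<rightarrow>\<^sub>E {0..<length bs}. inj_on f I}. ?T I f) = (\<Sum>J\<in>?Q. ?\<delta> (subgraph_on I J))" if I: "I \<in> ?P" for I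
  proof -
    let ?F = "{f \<in> I \<rightarrow>\<^sub>E {0..<length bs}. inj_on f I}"
    have finI: "finite I" using I finite_subset by blast
    have finF: "finite ?F"
      by (rule finite_subset[of _ "I \<rightarrow>\<^sub>E {0..<length bs}"]) (auto simp: finI intro: finite_PiE)
    have im: "(\<lambda>f. f ` I) ` ?F \<subseteq> ?Q" using I by (auto simp: card_image)
    have "(\<Sum>f\<in>?F. ?T I f) = (\<Sum>J\<in>?Q. \<Sum>f\<in>{f \<in> ?F. f ` I = J}. ?T I f)"
      by (rule sum.group[OF finF fin(2) im, symmetric])
    also have "\<dots> = (\<Sum>J\<in>?Q. ?\<delta> (subgraph_on I J))"
    proof (rule sum.cong[OF refl])
      fix J assume J: "J \<in> ?Q"
      have "{f \<in> ?F. f ` I = J} = bijections I J" by (auto simp: bijections_def)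
      moreover have "?\<delta> (subgraph_on I J) = \<delta> (total_class I J) (subgraph_on I J)" by (simp add: total_class_def[abs_def])
      ultimately show "(\<Sum>f\<in>{f \<in> ?F. f ` I = J}. ?T I f) = ?\<delta> (subgraph_on I J)"
        using \<delta>_subgraph_on[of I J] I J by simp
    qed
    finally show ?thesis .
  qed
  then have "(\<Sum>I\<in>?P. \<Sum>f\<in>{f \<in> I \<rightarrow>\<^sub>E {0..<length bs}. inj_on f I}. ?T I f) = (\<Sum>I\<in>?P. \<Sum>J\<in>?Q. ?\<delta> (subgraph_on I J))"
    by (rule sum.cong[OF refl])
  also have "\<dots> = (\<Sum>(I, J)\<in>Sigma ?P (\<lambda>_. ?Q). ?\<delta> (subgraph_on I J))"
    using fin by (intro sum.Sigma) auto
  also have "\<dots> = (\<Sum>p\<in>Sigma ?P (\<lambda>_. ?Q). ?\<delta> (case p of (I, J) \<Rightarrow> subgraph_on I J))"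
    by (intro sum.cong) auto
  also have "\<dots> = (\<Sum>H\<in>{H \<in> induced_subgraphs G. balanced H \<and> card (verts H) = 2 * m}. ?\<delta> H)"
    by (rule sum.reindex_bij_betw[OF bij_balanced_subgraphs])
  finally show ?thesis unfolding coeff_singular_polynomial[OF carrier m] by (rule arg_cong)
qed

end

theorem theorem2p2:
  fixes G :: plane_graph
    and ws bs :: "complex list"
    and A :: "complex Matrix.mat"
    and \<a> :: "chain \<Rightarrow> circle"
    and n m :: nat
  assumes "plane_bipartite_graph G"
    and "numbering (white G) ws"
    and "numbering (black G) bs"
    and "n = card (white G)"
    and "generalized_kasteleyn_matrix G ws bs A"
    and "\<a> = matrix_class G ws bs A"
    and "1 \<le> m" and "m \<le> n"
  shows "poly.coeff (singular_polynomial A) (n - m) =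
    (-1) ^ m *
    (\<Sum>H | H \<in> induced_subgraphs G \<and> balanced H \<and> card (verts H) = 2 * m.
       \<delta> (\<lambda>c. restrict_class H \<a> c + half (kasteleyn_class H c)) H)"
proof -
  interpret kasteleyn_matrix G ws bs A
    using assms(1,2,3,5) by unfold_locales
  have "n = length ws" using assms(2,4) using distinct_card[of ws] by (simp add: numbering_def)
  then show ?thesis using singular_polynomial_coeff[of m] assms(6,8) by simp
qed

end
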